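(* Let $q$ be a prime power, let $\ell, N$ be positive integers, and let $n = \ell N$ be a sum-rank length partition with equal sublengths $N = n_1 = n_2 = \cdots = n_\ell$ (extension degree $m=1$). Let $\mathcal{C}, \mathcal{D} \subseteq \mathbb{F}_q^n$ be two proper sum-rank Hamming codes with $r = n - \dim(\mathcal{C}) = n - \dim(\mathcal{D})$ and with parity-check matrices given by $$ H = (H_1, H_2, \ldots, H_\ell) \in \mathbb{F}_q^{r\times n} \quad\text{and}\quad L = (L_1, L_2, \ldots, L_\ell) \in \mathbb{F}_q^{r \times n}, $$ respectively, where $H_i, L_i \in \mathbb{F}_q^{r \times N}$. Denote $\mathcal{H}_i = \mathrm{Col}(H_i) \subseteq \mathbb{F}_q^r$ and $\mathcal{L}_i = \mathrm{Col}(L_i) \subseteq \mathbb{F}_q^r$, for $i = 1,2,\ldots,\ell$. Then $\mathcal{C}$ and $\mathcal{D}$ are sum-rank isometric if, and only if, $$ \{\mathcal{H}_1, \mathcal{H}_2, \ldots, \mathcal{H}_\ell\} = \{\mathcal{L}_1, \mathcal{L}_2, \ldots, \mathcal{L}_\ell\}. $$ In particular, sum-rank isometry classes of proper sum-rank Hamming codes with the sum-rank length partition $n = \ell N$ and redundancy $r$ correspond bijectively with maximal-size partial $N$-spreads in $\mathbb{F}_q^r$.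
   Context: Sum-rank metric for $m=1$: for $\mathbf{c} = (\mathbf{c}^{(1)}, \ldots, \mathbf{c}^{(\ell)}) \in \mathbb{F}_q^n$ with $\mathbf{c}^{(i)} \in \mathbb{F}_q^{N}$, the sum-rank weight is $\mathrm{wt}_{SR}(\mathbf{c}) = \sum_{i=1}^\ell \mathrm{Rk}(\mathbf{c}^{(i)})$, where $\mathbf{c}^{(i)}$ is viewed as a $1\times N$ matrix over $\mathbb{F}_q$ (so the weight is the number of nonzero blocks), and $\mathrm{d}_{SR}(\mathbf{c},\mathbf{d}) = \mathrm{wt}_{SR}(\mathbf{c}-\mathbf{d})$. For a linear code (subspace) $\mathcal{C}$, $\mathrm{d}_{SR}(\mathcal{C}) = \min\{\mathrm{wt}_{SR}(\mathbf{c}) \mid \mathbf{c} \in \mathcal{C}\setminus\{\mathbf{0}\}\}$. Two linear codes $\mathcal{C},\mathcal{D}\subseteq\mathbb{F}_q^n$ are sum-rank isometric if there is an $\mathbb{F}_q$-linear map $\phi:\mathbb{F}_q^n\to\mathbb{F}_q^n$ preserving $\mathrm{d}_{SR}$ with $\mathcal{D} = \phi(\mathcal{C})$. Proper sum-rank Hamming code ($m=1$): for fixed $q$ and redundancy $r$, a linear code $\mathcal{C} \subseteq \mathbb{F}_q^n$, $n = \ell N$, such that $\mathrm{d}_{SR}(\mathcal{C}) \geq 3$, $r = n - \dim(\mathcal{C})$, and there is no other linear code $\mathcal{C}' \subseteq \mathbb{F}_q^{n'}$ with $\mathrm{d}_{SR}(\mathcal{C}') \geq 3$ and $r = n' - \dim(\mathcal{C}')$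 for a sum-rank length partition $n' = \ell' N$ into $\ell'$ blocks of the same length $N$ with $\ell' > \ell$. A parity-check matrix of a linear code $\mathcal{C}\subseteq\mathbb{F}_q^n$ of redundancy $r$ is a matrix $H \in \mathbb{F}_q^{r\times n}$ of rank $r$ with $\mathcal{C} = \{\mathbf{c} \in \mathbb{F}_q^n \mid H\mathbf{c}^T = \mathbf{0}\}$. $\mathrm{Col}(X)$ is the space spanned by the columns of $X$. Partial spreads: for $1 \leq N \leq r$, a partial $N$-spread in $\mathbb{F}_q^r$ is a family $\{\mathcal{H}_i\}_{i\in I}$ of $N$-dimensional subspaces of $\mathbb{F}_q^r$ with $\mathcal{H}_i \cap \mathcal{H}_j = \{\mathbf{0}\}$ whenever $i \neq j$. It is maximal-size if $I$ has maximal size among partial $N$-spreads in $\mathbb{F}_q^r$.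
   Formalization: Parity-check matrices are unique only up to left multiplication by GL_r(F_q), so the literal "only if" and bijection fail. Proved: "if" as stated; isometric iff the families agree up to GL_r (or for a suitable L); isometry classes biject with maximal-size partial N-spreads modulo GL_r. *)

theory Defs
  imports "Jordan_Normal_Form.DL_Rank" "HOL-Library.Extended_Nat"
begin

text \<open>
  The field with q elements is a type \<open>'a :: {field, finite}\<close>, so q is \<open>CARD('a)\<close>. The space
  of vectors of length n over it is \<open>module_vec TYPE('a) n\<close>. Sum-rank lengths are
  \<open>n = l * N\<close>: l blocks of length N each, with extension degree m = 1. Blocks are indexed
  from 0.
\<close>

section \<open>Sum-rank metric\<close>

definition vec_block :: "nat \<Rightarrow> nat \<Rightarrow> 'a vec \<Rightarrow> 'a vec" where
  "vec_block N i c = vec N (\<lambda>j. c $ (i * N + j))"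

definition wt_SR :: "nat \<Rightarrow> nat \<Rightarrow> 'a::field vec \<Rightarrow> nat" where
  "wt_SR N l c = (\<Sum>i<l. vec_space.rank 1 (mat_of_row (vec_block N i c)))"

definition d_SR :: "nat \<Rightarrow> nat \<Rightarrow> 'a::field vec \<Rightarrow> 'a vec \<Rightarrow> nat" where
  "d_SR N l c d = wt_SR N l (c - d)"

definition linear_code :: "nat \<Rightarrow> 'a::field vec set \<Rightarrow> bool" where
  "linear_code n C \<longleftrightarrow> VectorSpace.subspace class_ring C (module_vec TYPE('a) n)"

definition subspace_dim :: "nat \<Rightarrow> 'a::field vec set \<Rightarrow> nat" where
  "subspace_dim n W = vectorspace.dim class_ring (module_vec TYPE('a) n\<lparr>carrier := W\<rparr>)"

text \<open>The minimum over the empty set is infinite, so the zero code has infinite distance.\<close>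

definition code_dist :: "nat \<Rightarrow> nat \<Rightarrow> 'a::field vec set \<Rightarrow> enat" where
  "code_dist N l C = (INF c \<in> C - {0\<^sub>v (l * N)}. enat (wt_SR N l c))"

definition SR_isometric :: "nat \<Rightarrow> nat \<Rightarrow> 'a::field vec set \<Rightarrow> 'a vec set \<Rightarrow> bool" where
  "SR_isometric N l C D \<longleftrightarrow>
     (\<exists>\<phi>. linear_map class_ring (module_vec TYPE('a) (l * N)) (module_vec TYPE('a) (l * N)) \<phi> \<and>
          (\<forall>c \<in> carrier_vec (l * N). \<forall>d \<in> carrier_vec (l * N).
             d_SR N l (\<phi> c) (\<phi> d) = d_SR N l c d) \<and>
          D = \<phi> ` C)"

section \<open>Proper sum-rank Hamming codes\<close>

definition SR_code3 :: "nat \<Rightarrow> nat \<Rightarrow> nat \<Rightarrow> 'a::field vec set \<Rightarrow> bool" where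
  "SR_code3 N r l C \<longleftrightarrow> linear_code (l * N) C \<and> code_dist N l C \<ge> 3 \<and>
     r + subspace_dim (l * N) C = l * N"

definition proper_SR_Hamming :: "nat \<Rightarrow> nat \<Rightarrow> nat \<Rightarrow> 'a::field vec set \<Rightarrow> bool" where
  "proper_SR_Hamming N r l C \<longleftrightarrow> SR_code3 N r l C \<and>
     \<not> (\<exists>l' (C' :: 'a vec set). l' > l \<and> SR_code3 N r l' C')"

definition parity_check :: "nat \<Rightarrow> nat \<Rightarrow> 'a::field vec set \<Rightarrow> 'a mat \<Rightarrow> bool" where
  "parity_check r n C H \<longleftrightarrow> H \<in> carrier_mat r n \<and> vec_space.rank r H = r \<and>
     C = {c \<in> carrier_vec n. H *\<^sub>v c = 0\<^sub>v r}"

definition mat_block :: "nat \<Rightarrow> nat \<Rightarrow> 'a mat \<Rightarrow> 'a mat" where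
  "mat_block N i H = mat (dim_row H) N (\<lambda>(a, b). H $$ (a, i * N + b))"

definition Col :: "'a::field mat \<Rightarrow> 'a vec set" where
  "Col X = vec_space.col_space (dim_row X) X"

definition block_cols :: "nat \<Rightarrow> nat \<Rightarrow> 'a::field mat \<Rightarrow> 'a vec set set" where
  "block_cols N l H = {Col (mat_block N i H) | i. i < l}"

section \<open>Partial spreads\<close>

text \<open>
  For \<open>N \<ge> 1\<close> the members of a partial N-spread are nonzero and meet trivially, hence are
  distinct, so the families are represented by sets.
\<close>

definition partial_spread :: "nat \<Rightarrow> nat \<Rightarrow> 'a::field vec set set \<Rightarrow> bool" where
  "partial_spread N r S \<longleftrightarrow> 1 \<le> N \<and> N \<le> r \<and>
     (\<forall>U \<in> S. VectorSpace.subspace class_ring U (module_vec TYPE('a) r) \<and> subspace_dim r U = N) \<and>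
     (\<forall>U \<in> S. \<forall>W \<in> S. U \<noteq> W \<longrightarrow> U \<inter> W = {0\<^sub>v r})"

definition max_partial_spread :: "nat \<Rightarrow> nat \<Rightarrow> 'a::field vec set set \<Rightarrow> bool" where
  "max_partial_spread N r S \<longleftrightarrow> partial_spread N r S \<and>
     (\<forall>S' :: 'a vec set set. partial_spread N r S' \<longrightarrow> card S' \<le> card S)"

text \<open>
  A parity-check matrix is determined by its code only up to multiplication on the left by an
  invertible matrix, that is, up to a change of basis of the r-dimensional space in which the
  column spaces lie.
\<close>

definition GL_equivalent :: "nat \<Rightarrow> 'a::field vec set set \<Rightarrow> 'a vec set set \<Rightarrow> bool" where
  "GL_equivalent r S T \<longleftrightarrow>
     (\<exists>A \<in> carrier_mat r r. invertible_mat A \<and> T = (\<lambda>U. (\<lambda>v. A *\<^sub>v v) ` U) ` S)"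

definition code_isometry_rel :: "nat \<Rightarrow> nat \<Rightarrow> nat \<Rightarrow> ('a::field vec set \<times> 'a vec set) set" where
  "code_isometry_rel N r l = {(C, D). proper_SR_Hamming N r l C \<and> proper_SR_Hamming N r l D \<and>
     SR_isometric N l C D}"

definition spread_GL_rel ::
  "nat \<Rightarrow> nat \<Rightarrow> ('a::field vec set set \<times> 'a vec set set) set" where
  "spread_GL_rel N r = {(S, T). max_partial_spread N r S \<and> max_partial_spread N r T \<and>
     GL_equivalent r S T}"

end

theory Submission
  imports Defs "HOL-Algebra.Algebraic_Closure_Type" "HOL-Library.Cardinality" "HOL-Number_Theory.Residues"
begin

text \<open>
  A code has distance at least 3 iff the blocks of its parity-check matrix have full column rank and
  their column spaces meet trivially, that is, form a partial spread. A linear map preserving the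
  number of nonzero blocks permutes the block subspaces, so it carries a parity-check matrix to one
  with the same column spaces; conversely, equal column spaces allow one to match the syndromes block
  by block. Two parity-check matrices of one code differ by an invertible factor on the left.

  For the correspondence of classes, every maximal-size partial spread must span the whole space,
  since parity-check matrices have rank r. If a proper code exists, then \<open>r = N\<close> (trivial) or
  \<open>r \<ge> 2 * N\<close>. In the second case a spread inside a hyperplane has fewer than
  \<open>q^(r-1) / (q^N - 1)\<close> members, while lifting the multiplication of the field with
  \<open>q^(r-N)\<close> elements gives a spread with \<open>q^(r-N)\<close> members, which is more.
\<close>

section \<open>Linear codes over a finite field\<close>

text \<open>Over a field with q elements a subspace of dimension k has q^k elements, so ranks,
  kernels, injectivity and surjectivity are compared by counting finite sets. The obstacle is the
  rank condition: the blocks built from a maximal-size partial spread form a parity-check matrix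
  only if the spread spans. The two bounds clash because q^(r-N) * (q^N - 1) = q^r - q^(r-N) is at
  least q^r - q^(r-1), hence at least q^(r-1). The alternative for r comes from the existing code: a
  single block forces r = N by the rank condition, and two blocks whose column spaces meet trivially
  force 2 * N <= r. With M = r - N, the lifting needs q^M square matrices of size M that pairwise
  agree only on the zero vector. They come from a field with q^M elements, realised as the fixed
  points of a power map in the algebraic closure. That these are closed under addition requires q to
  be a power of the characteristic; this explains the detour through Frobenius maps.\<close>

lemma linear_code_iff:
  "linear_code n (W :: 'a::field vec set) \<longleftrightarrow>
     W \<subseteq> carrier_vec n \<and> 0\<^sub>v n \<in> W \<and> (\<forall>u\<in>W. \<forall>v\<in>W. u + v \<in> W) \<and> (\<forall>a. \<forall>v\<in>W. a \<cdot>\<^sub>v v \<in> W)"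
proof -
  interpret vec_space "TYPE('a)" n .
  have "Module.module class_ring (module_vec TYPE('a) n)" ..
  moreover have "vectorspace class_ring (module_vec TYPE('a) n)" ..
  ultimately show ?thesis
    unfolding linear_code_def VectorSpace.subspace_def submodule_def
    by (auto simp: module_vec_simps class_ring_simps)
qed

lemma linear_codeD:
  assumes "linear_code n (W :: 'a::field vec set)"
  shows "W \<subseteq> carrier_vec n" "0\<^sub>v n \<in> W" "u \<in> W \<Longrightarrow> v \<in> W \<Longrightarrow> u + v \<in> W"
    "v \<in> W \<Longrightarrow> a \<cdot>\<^sub>v v \<in> W" "u \<in> W \<Longrightarrow> v \<in> W \<Longrightarrow> u - v \<in> W"
proof -
  show 1: "W \<subseteq> carrier_vec n" "0\<^sub>v n \<in> W" "u \<in> W \<Longrightarrow> v \<in> W \<Longrightarrow> u + v \<in> W"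
    "v \<in> W \<Longrightarrow> a \<cdot>\<^sub>v v \<in> W"
    for u v a using assms unfolding linear_code_iff by auto
  show "u - v \<in> W" if "u \<in> W" "v \<in> W"
  proof -
    have "u - v = u + (-1) \<cdot>\<^sub>v v" using that 1(1) by (intro eq_vecI) auto
    thus ?thesis using 1(3,4) that by metis
  qed
qed

lemma linear_map_iff:
  "linear_map class_ring (module_vec TYPE('a::field) n) (module_vec TYPE('a) m) \<phi> \<longleftrightarrow>
     (\<forall>u\<in>carrier_vec n. \<phi> u \<in> carrier_vec m) \<and>
     (\<forall>u\<in>carrier_vec n. \<forall>v\<in>carrier_vec n. \<phi> (u + v) = \<phi> u + \<phi> v) \<and>
     (\<forall>a. \<forall>u\<in>carrier_vec n. \<phi> (a \<cdot>\<^sub>v u) = a \<cdot>\<^sub>v \<phi> u)"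
proof -
  interpret V: vec_space "TYPE('a)" n .
  interpret W: vec_space "TYPE('a)" m .
  have "Module.module class_ring (module_vec TYPE('a) n)" ..
  moreover have "Module.module class_ring (module_vec TYPE('a) m)" ..
  moreover have "vectorspace class_ring (module_vec TYPE('a) n)" ..
  moreover have "vectorspace class_ring (module_vec TYPE('a) m)" ..
  ultimately show ?thesis
    unfolding linear_map_def mod_hom_def mod_hom_axioms_def LinearCombinations.module_hom_def
    by (auto simp: module_vec_simps class_ring_simps)
qed

lemma finite_carrier_vec: "finite (carrier_vec n :: 'a::finite vec set)"
proof -
  have "inj_on list_of_vec (carrier_vec n :: 'a vec set)"
    by (metis inj_onI vec_list)
  moreover have "list_of_vec ` (carrier_vec n :: 'a vec set) \<subseteq> {xs. set xs \<subseteq> UNIV \<and> length xs = n}"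
    by auto
  ultimately show ?thesis
    using inj_on_finite finite_lists_length_eq[OF finite[of "UNIV :: 'a set"]] by blast
qed

lemma linear_code_finite: "linear_code n (W :: 'a::{field,finite} vec set) \<Longrightarrow> finite W"
  by (rule finite_subset[OF linear_codeD(1) finite_carrier_vec])

lemma (in vectorspace) finite_carrier_fin_dim: "finite (carrier V) \<Longrightarrow> fin_dim"
  unfolding fin_dim_def
  by (metis dual_order.refl in_own_span span_is_subset2 subset_antisym)

text \<open>Coordinates in a basis \<open>B\<close> identify the space with the functions from
  \<open>B\<close> to the field. From here on dimensions are read off from cardinalities.\<close>

lemma card_vectorspace:
  assumes "vectorspace (class_ring :: 'a::{field,finite} ring) V" and "finite (carrier V)"
  shows "card (carrier V) = CARD('a) ^ vectorspace.dim class_ring V"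
proof -
  interpret vectorspace "class_ring :: 'a ring" V by fact
  have "fin_dim" using assms(2) by (rule finite_carrier_fin_dim)
  then obtain B where B: "finite B" "basis B" using finite_basis_exists by blast
  have sub: "B \<subseteq> carrier V" using B(2) unfolding basis_def by auto
  have K: "carrier (class_ring :: 'a ring) = UNIV" by (simp add: class_ring_simps)
  have uniq: "\<forall>v. v\<in> carrier V \<longrightarrow> (\<exists>! a.  a\<in>B \<rightarrow>\<^sub>E UNIV \<and> lincomb a B = v)"
    using basis_criterion[OF B(1) sub] B(2) unfolding K by blast
  have "bij_betw (\<lambda>a. lincomb a B) (B \<rightarrow>\<^sub>E UNIV) (carrier V)"
    unfolding bij_betw_def
  proof
    have cl: "lincomb a B \<in> carrier V" if "a \<in> B \<rightarrow>\<^sub>E UNIV" for a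
      using that sub K by (intro lincomb_closed) auto
    show "inj_on (\<lambda>a. lincomb a B) (B \<rightarrow>\<^sub>E UNIV)"
      using uniq cl by (intro inj_onI) metis
    show "(\<lambda>a. lincomb a B) ` (B \<rightarrow>\<^sub>E UNIV) = carrier V"
      using uniq cl by (auto simp: image_iff)
  qed
  hence "card (carrier V) = card (B \<rightarrow>\<^sub>E (UNIV :: 'a set))" by (metis bij_betw_same_card)
  also have "\<dots> = CARD('a) ^ card B" using B(1) by (simp add: card_PiE)
  finally show ?thesis using dim_basis[OF B] by simp
qed

lemma card_linear_code:
  assumes "linear_code n (W :: 'a::{field,finite} vec set)"
  shows "card W = CARD('a) ^ subspace_dim n W"
proof -
  interpret vec_space "TYPE('a)" n .
  have "vectorspace class_ring (vs W)"
    using assms unfolding linear_code_def by (intro subspace_is_vs)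
  from card_vectorspace[OF this] linear_code_finite[OF assms] show ?thesis
    by (simp add: subspace_dim_def)
qed

lemma card_carrier_vec: "card (carrier_vec n :: 'a::{field,finite} vec set) = CARD('a) ^ n"
proof -
  interpret vec_space "TYPE('a)" n .
  have "vectorspace class_ring V" ..
  from card_vectorspace[OF this] finite_carrier_vec[where 'a='a] show ?thesis
    by (simp add: dim_is_n)
qed

lemma field_card_gt_1: "CARD('a::{field,finite}) > 1"
proof -
  have "card {0, 1 :: 'a} \<le> CARD('a)" by (intro card_mono) auto
  thus ?thesis by simp
qed

lemma subspace_dim_eq_iff:
  assumes "linear_code n (W :: 'a::{field,finite} vec set)"
  shows "subspace_dim n W = k \<longleftrightarrow> card W = CARD('a) ^ k"
  using card_linear_code[OF assms] field_card_gt_1[where 'a='a] by auto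

lemma linear_code_carrier: "linear_code n (carrier_vec n)"
  unfolding linear_code_iff by auto

text \<open>The column space has q^\<open>rank H\<close> elements, so it fills
  \<open>carrier_vec r\<close> exactly when the rank is r. Surjectivity is the form in which full
  row rank of a parity-check matrix is used.\<close>

lemma rank_eq_dim_row_iff:
  assumes "H \<in> carrier_mat r n"
  shows "vec_space.rank r H = r \<longleftrightarrow>
     (\<lambda>x. H *\<^sub>v x) ` carrier_vec n = (carrier_vec r :: 'a::{field,finite} vec set)"
proof -
  interpret vec_space "TYPE('a)" r .
  have eq: "col_space H = (\<lambda>x. H *\<^sub>v x) ` carrier_vec n"
    using col_space_eq[OF assms] assms by auto
  have lc: "linear_code r (col_space H)" unfolding linear_code_def col_space_def
    using assms cols_dim[of H] by (intro span_is_subspace) auto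
  have "rank H = subspace_dim r (col_space H)"
    unfolding subspace_dim_def rank_def col_space_def by simp
  hence "rank H = r \<longleftrightarrow> card (col_space H) = card (carrier_vec r :: 'a vec set)"
    using subspace_dim_eq_iff[OF lc] by (simp add: card_carrier_vec)
  also have "\<dots> \<longleftrightarrow> col_space H = carrier_vec r"
    using card_subset_eq[OF finite_carrier_vec linear_codeD(1)[OF lc]] by auto
  finally show ?thesis unfolding eq .
qed

lemma Col_eq: "Col A = (\<lambda>x. A *\<^sub>v x) ` carrier_vec (dim_col A)"
proof -
  have A: "A \<in> carrier_mat (dim_row A) (dim_col A)" by auto
  show ?thesis unfolding Col_def vec_space.col_space_eq[OF A] using mult_mat_vec_carrier[OF A] by auto
qed

text \<open>Each fibre of \<open>f\<close> is a translate of \<open>Z\<close>, as in the coset count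
  behind Lagrange's theorem.\<close>

lemma card_fibers:
  assumes W: "linear_code n (W :: 'a::{field,finite} vec set)" and "Z \<subseteq> W"
    and f: "\<And>u v. u \<in> W \<Longrightarrow> v \<in> W \<Longrightarrow> f u = f v \<longleftrightarrow> u - v \<in> Z"
  shows "card W = card (f ` W) * card Z"
proof -
  have fin: "finite W" using linear_code_finite[OF W] .
  have sub: "W \<subseteq> carrier_vec n" using linear_codeD(1)[OF W] .
  have "card {w \<in> W. f w = y} = card Z" if y: "y \<in> f ` W" for y
  proof -
    obtain u where u: "u \<in> W" "f u = y" using y by auto
    have "bij_betw (\<lambda>z. z + u) Z {w \<in> W. f w = y}"
    proof (intro bij_betw_byWitness[where f' = "\<lambda>w. w - u"])
      have dims: "w \<in> W \<Longrightarrow> w \<in> carrier_vec n" for w using sub by auto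
      show "\<forall>z\<in>Z. z + u - u = z"
      proof
        fix z assume "z \<in> Z"
        hence "z \<in> carrier_vec n" "u \<in> carrier_vec n" using dims u \<open>Z \<subseteq> W\<close> by auto
        thus "z + u - u = z" by auto
      qed
      show "\<forall>w\<in>{w \<in> W. f w = y}. w - u + u = w"
      proof
        fix w assume "w \<in> {w \<in> W. f w = y}"
        hence "w \<in> carrier_vec n" "u \<in> carrier_vec n" using dims u by auto
        thus "w - u + u = w" by auto
      qed
      show "(\<lambda>w. w - u) ` {w \<in> W. f w = y} \<subseteq> Z" using f u by auto
      show "(\<lambda>z. z + u) ` Z \<subseteq> {w \<in> W. f w = y}"
      proof clarsimp
        fix z assume z: "z \<in> Z"
        hence zW: "z \<in> W" using \<open>Z \<subseteq> W\<close> by auto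
        hence zu: "z + u \<in> W" using linear_codeD(3)[OF W] u by auto
        have "z + u - u = z" using dims[OF zW] dims[OF u(1)] by auto
        hence "f (z + u) = f u" using f[OF zu u(1)] z by metis
        thus "z + u \<in> W \<and> f (z + u) = y" using zu u by metis
      qed
    qed
    from bij_betw_same_card[OF this] show ?thesis by simp
  qed
  moreover have "card W = (\<Sum>y\<in>f ` W. card {w \<in> W. f w = y})"
    using sum.image_gen[OF fin, of "\<lambda>_. 1::nat" f] by simp
  ultimately show ?thesis by simp
qed

lemma mult_mat_vec_diff:
  assumes "M \<in> carrier_mat r n" "u \<in> carrier_vec n" "v \<in> carrier_vec n"
  shows "M *\<^sub>v (u - v) = M *\<^sub>v u - M *\<^sub>v (v :: 'a::field vec)"
  using assms by (rule mult_minus_distrib_mat_vec)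

lemma vec_diff_eq_0_iff:
  assumes "u \<in> carrier_vec n" "v \<in> carrier_vec n"
  shows "u - v = 0\<^sub>v n \<longleftrightarrow> u = (v :: 'a::field vec)"
proof
  assume "u - v = 0\<^sub>v n"
  hence "(u - v) $ i = 0" if "i < n" for i using that by simp
  thus "u = v" using assms by (intro eq_vecI) auto
qed (use assms in auto)

text \<open>Rank-nullity in multiplicative form: two vectors have the same image exactly when their
  difference is in the kernel.\<close>

lemma card_image_kernel:
  assumes M: "M \<in> carrier_mat r n" and W: "linear_code n (W :: 'a::{field,finite} vec set)"
  shows "card W = card ((\<lambda>x. M *\<^sub>v x) ` W) * card {w \<in> W. M *\<^sub>v w = 0\<^sub>v r}"
proof (rule card_fibers[OF W])
  fix u v assume uv: "u \<in> W" "v \<in> W"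
  hence c: "u \<in> carrier_vec n" "v \<in> carrier_vec n" using linear_codeD(1)[OF W] by auto
  have "M *\<^sub>v (u - v) = 0\<^sub>v r \<longleftrightarrow> M *\<^sub>v u = M *\<^sub>v v"
    unfolding mult_mat_vec_diff[OF M c] using vec_diff_eq_0_iff M c by (metis mult_mat_vec_carrier)
  thus "M *\<^sub>v u = M *\<^sub>v v \<longleftrightarrow> u - v \<in> {w \<in> W. M *\<^sub>v w = 0\<^sub>v r}"
    using linear_codeD(5)[OF W] uv by auto
qed auto

lemma linear_code_image:
  assumes M: "M \<in> carrier_mat r n" and W: "linear_code n (W :: 'a::field vec set)"
  shows "linear_code r ((\<lambda>x. M *\<^sub>v x) ` W)"
proof -
  have "\<exists>w\<in>W. M *\<^sub>v u + M *\<^sub>v v = M *\<^sub>v w" if "u \<in> W" "v \<in> W" for u v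
    using that linear_codeD[OF W] mult_add_distrib_mat_vec[OF M] by (metis subsetD)
  moreover have "\<exists>w\<in>W. a \<cdot>\<^sub>v (M *\<^sub>v u) = M *\<^sub>v w" if "u \<in> W" for u a
    using that linear_codeD[OF W] mult_mat_vec[OF M] by (metis subsetD)
  moreover have "\<exists>w\<in>W. 0\<^sub>v r = M *\<^sub>v w"
    using linear_codeD(2)[OF W] M by (intro bexI[of _ "0\<^sub>v n"]) auto
  ultimately show ?thesis
    unfolding linear_code_iff using M linear_codeD(1)[OF W] by (auto simp: image_iff)
qed

lemma linear_code_kernel:
  assumes M: "M \<in> carrier_mat r n"
  shows "linear_code n {c \<in> carrier_vec n. M *\<^sub>v c = (0\<^sub>v r :: 'a::field vec)}"
  unfolding linear_code_iff using M
  by (auto simp: mult_add_distrib_mat_vec[OF M] mult_mat_vec[OF M])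

lemma linear_map_mat:
  assumes "linear_map class_ring (module_vec TYPE('a::field) n) (module_vec TYPE('a) m) \<phi>"
  obtains M where "M \<in> carrier_mat m n" "\<And>x. x \<in> carrier_vec n \<Longrightarrow> M *\<^sub>v x = \<phi> x"
proof
  define M where "M = mat_of_cols m (map (\<lambda>i. \<phi> (unit_vec n i)) [0..<n])"
  show M: "M \<in> carrier_mat m n" by (simp add: M_def mat_of_cols_def)
  have \<phi>: "u \<in> carrier_vec n \<Longrightarrow> \<phi> u \<in> carrier_vec m"
     "u \<in> carrier_vec n \<Longrightarrow> v \<in> carrier_vec n \<Longrightarrow> \<phi> (u + v) = \<phi> u + \<phi> v"
     "u \<in> carrier_vec n \<Longrightarrow> \<phi> (a \<cdot>\<^sub>v u) = a \<cdot>\<^sub>v \<phi> u" for u v a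
    using assms unfolding linear_map_iff by auto
  fix x :: "'a vec" assume x: "x \<in> carrier_vec n"
  \<comment> \<open>\<open>t k\<close> keeps the first k coordinates of \<open>x\<close> and sets
    the others to 0, so that additivity is used for one coordinate at a time.\<close>
  define t where "t k = vec n (\<lambda>i. if i < k then x $ i else 0)" for k
  have t: "t k \<in> carrier_vec n" for k by (simp add: t_def)
  have "k \<le> n \<Longrightarrow> M *\<^sub>v t k = \<phi> (t k)" for k
  proof (induction k)
    case 0
    \<comment> \<open>The zero vector is written as a multiple by 0, so homogeneity of \<phi> gives
      its value.\<close>
    have "t 0 = 0 \<cdot>\<^sub>v t 0" "M *\<^sub>v t 0 = 0\<^sub>v m" using M by (auto simp: t_def scalar_prod_def)
    moreover have "0 \<cdot>\<^sub>v \<phi> (t 0) = 0\<^sub>v m" using \<phi>(1)[OF t, of 0] by auto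
    ultimately show ?case using \<phi>(3)[OF t, of 0 0] by metis
  next
    case (Suc k)
    have s: "t (Suc k) = t k + x $ k \<cdot>\<^sub>v unit_vec n k"
      using Suc.prems by (auto simp: t_def less_Suc_eq)
    have "M *\<^sub>v unit_vec n k = col M k" 
      using M Suc.prems by (intro eq_vecI) (auto simp: scalar_prod_right_unit)
    also have "\<dots> = \<phi> (unit_vec n k)" using Suc.prems \<phi>(1) by (simp add: M_def)
    finally have u: "M *\<^sub>v unit_vec n k = \<phi> (unit_vec n k)" .
    have "M *\<^sub>v t (Suc k) = M *\<^sub>v t k + x $ k \<cdot>\<^sub>v (M *\<^sub>v unit_vec n k)"
      unfolding s using t by (simp add: mult_add_distrib_mat_vec[OF M] mult_mat_vec[OF M])
    also have "\<dots> = \<phi> (t (Suc k))" unfolding s u using Suc t by (simp add: \<phi>)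
    finally show ?case .
  qed
  moreover have "t n = x" using x by (auto simp: t_def)
  ultimately show "M *\<^sub>v x = \<phi> x" by (metis order_refl)
qed

section \<open>Blocks of vectors and matrices\<close>

text \<open>Coordinate k lies in block \<open>k div N\<close>. As a single row has rank 0 or 1, the
  weight is the cardinality of this set, and the proof works with supports instead of ranks.\<close>

definition block_supp :: "nat \<Rightarrow> 'a::zero vec \<Rightarrow> nat set" where
  "block_supp N c = {k div N |k. k < dim_vec c \<and> c $ k \<noteq> 0}"

text \<open>The vectors keep their full length, so that the whole parity-check matrix can be applied
  to them and column spaces of blocks become images under one map.\<close>

definition block_space :: "nat \<Rightarrow> nat \<Rightarrow> nat \<Rightarrow> 'a::zero vec set" where
  "block_space N l i = {c \<in> carrier_vec (l * N). block_supp N c \<subseteq> {i}}"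

definition block_part :: "nat \<Rightarrow> nat \<Rightarrow> 'a::zero vec \<Rightarrow> 'a vec" where
  "block_part N i c = vec (dim_vec c) (\<lambda>k. if k div N = i then c $ k else 0)"

lemma div_block_less: "(k::nat) < l * N \<Longrightarrow> k div N < l"
  by (simp add: less_mult_imp_div_less)

lemma block_index_less: "i < l \<Longrightarrow> b < N \<Longrightarrow> i * N + b < l * (N::nat)"
proof -
  assume "i < l" "b < N"
  hence "i * N + b < Suc i * N" by simp
  also have "\<dots> \<le> l * N" using \<open>i < l\<close> by (intro mult_le_mono1) simp
  finally show ?thesis .
qed

lemma block_indices:
  assumes "i < l" "N \<ge> 1"
  shows "{k. k < l * N \<and> k div N = i} = (\<lambda>b. i * N + b) ` {..<N::nat}"
proof (intro equalityI subsetI)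
  fix k assume "k \<in> {k. k < l * N \<and> k div N = i}"
  hence "k = i * N + k mod N" "k mod N < N" using assms(2) by (auto simp: mult.commute[of _ N])
  thus "k \<in> (\<lambda>b. i * N + b) ` {..<N}" by blast
qed (use assms block_index_less in auto)

lemma block_supp_subset: "c \<in> carrier_vec (l * N) \<Longrightarrow> block_supp N c \<subseteq> {..<l}"
  by (auto simp: block_supp_def div_block_less)

lemma finite_block_supp: "finite (block_supp N c)"
  by (simp add: block_supp_def)

lemma block_supp_diff: "u \<in> carrier_vec n \<Longrightarrow> v \<in> carrier_vec n \<Longrightarrow>
    block_supp N (u - v :: 'a::field vec) \<subseteq> block_supp N u \<union> block_supp N v"
  by (auto simp: block_supp_def)

lemma block_supp_eq_empty_iff: "c \<in> carrier_vec n \<Longrightarrow> block_supp N c = {} \<longleftrightarrow> c = 0\<^sub>v n"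
  by (auto simp: block_supp_def intro!: eq_vecI)

text \<open>No entry cancels between disjoint supports. This makes a vector of weight 2 out of two
  vectors of weight 1.\<close>

lemma block_supp_diff_disjoint:
  fixes u v :: "'a::field vec"
  assumes "u \<in> carrier_vec n" "v \<in> carrier_vec n" "block_supp N u \<inter> block_supp N v = {}"
  shows "block_supp N (u - v) = block_supp N u \<union> block_supp N v"
proof
  show "block_supp N u \<union> block_supp N v \<subseteq> block_supp N (u - v)"
  proof
    fix i assume "i \<in> block_supp N u \<union> block_supp N v"
    then consider k where "k < n" "u $ k \<noteq> 0" "k div N = i" | k where "k < n" "v $ k \<noteq> 0" "k div N = i"
      using assms by (auto simp: block_supp_def)
    thus "i \<in> block_supp N (u - v)"
    proof cases
      case 1
      hence "i \<in> block_supp N u" using assms(1) by (auto simp: block_supp_def)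
      hence "i \<notin> block_supp N v" using assms(3) by auto
      hence "v $ k = 0" using assms(2) 1 by (auto simp: block_supp_def)
      thus ?thesis using 1 assms(1,2) by (auto simp: block_supp_def intro!: exI[of _ k])
    next
      case 2
      hence "i \<in> block_supp N v" using assms(2) by (auto simp: block_supp_def)
      hence "i \<notin> block_supp N u" using assms(3) by auto
      hence "u $ k = 0" using assms(1) 2 by (auto simp: block_supp_def)
      thus ?thesis using 2 assms(1,2) by (auto simp: block_supp_def intro!: exI[of _ k])
    qed
  qed
qed (rule block_supp_diff[OF assms(1,2)])

text \<open>A one-row matrix is an outer product, so its rank is at most 1; a nonzero entry gives a
  nonzero, hence independent, column.\<close>

lemma rank_mat_of_row:
  assumes "(v :: 'a::field vec) \<in> carrier_vec N"
  shows "vec_space.rank 1 (mat_of_row v) = (if v = 0\<^sub>v N then 0 else 1)"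
proof -
  interpret vec_space "TYPE('a)" 1 .
  have c: "mat_of_row v \<in> carrier_mat 1 N" using assms by auto
  show ?thesis
  proof (cases "v = 0\<^sub>v N")
    case True
    have "mat_of_row v = 0\<^sub>m 1 N" unfolding True by (intro eq_matI) auto
    thus ?thesis using True rank_0I by simp
  next
    case False
    then obtain k where k: "k < N" "v $ k \<noteq> 0" using assms by (metis eq_vecI carrier_vecD index_zero_vec)
    have "rank (mat_of_row v) \<le> 1"
      using c by (rule rank_le_1_product_entries[where f = "\<lambda>_. 1" and g = "\<lambda>j. v $ j"]) auto
    moreover have "card {col (mat_of_row v) k} \<le> rank (mat_of_row v)"
    proof (rule rank_ge_card_indpt[OF c])
      show "{col (mat_of_row v) k} \<subseteq> set (cols (mat_of_row v))"
        using k assms by (auto simp: cols_def)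
      have "col (mat_of_row v) k \<noteq> 0\<^sub>v 1"
      proof
        assume "col (mat_of_row v) k = 0\<^sub>v 1"
        hence "col (mat_of_row v) k $ 0 = 0" by simp
        thus False using k assms by simp
      qed
      moreover have "lin_indpt {}" unfolding lin_dep_def by auto
      moreover have "col (mat_of_row v) k \<in> carrier_vec 1" by (metis c carrier_matD(1) col_carrier_vec k(1) carrier_matD(2))
      ultimately show "lin_indpt {col (mat_of_row v) k}"
        using lin_dep_iff_in_span[of "{}" "col (mat_of_row v) k"] by (simp add: span_empty module_vec_simps del: One_nat_def)
    qed
    ultimately show ?thesis using False by simp
  qed
qed

lemma wt_SR_eq_card:
  assumes "(c :: 'a::field vec) \<in> carrier_vec (l * N)" and "N \<ge> 1"
  shows "wt_SR N l c = card (block_supp N c)"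
proof -
  have "vec_block N i c = 0\<^sub>v N \<longleftrightarrow> i \<notin> block_supp N c" if i: "i < l" for i
  proof -
    have "i \<notin> block_supp N c \<longleftrightarrow> (\<forall>k \<in> {k. k < l * N \<and> k div N = i}. c $ k = 0)"
      using assms(1) by (auto simp: block_supp_def)
    also have "\<dots> \<longleftrightarrow> (\<forall>b<N. c $ (i * N + b) = 0)" unfolding block_indices[OF i assms(2)] by auto
    also have "\<dots> \<longleftrightarrow> vec_block N i c = 0\<^sub>v N" by (auto simp: vec_block_def vec_eq_iff)
    finally show ?thesis ..
  qed
  hence "wt_SR N l c = (\<Sum>i<l. if i \<in> block_supp N c then 1 else 0)"
    unfolding wt_SR_def by (intro sum.cong refl) (subst rank_mat_of_row[of _ N], auto simp: vec_block_def)
  also have "\<dots> = card ({..<l} \<inter> block_supp N c)" by (simp add: sum.If_cases)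
  also have "{..<l} \<inter> block_supp N c = block_supp N c" using block_supp_subset[OF assms(1)] by auto
  finally show ?thesis .
qed

lemma block_space_iff:
  "c \<in> block_space N l i \<longleftrightarrow> c \<in> carrier_vec (l * N) \<and> (\<forall>k<l * N. k div N \<noteq> i \<longrightarrow> c $ k = 0)"
  by (cases "c \<in> carrier_vec (l * N)") (auto simp: block_space_def block_supp_def subset_iff)

lemma linear_code_block_space: "linear_code (l * N) (block_space N l i :: 'a::field vec set)"
  unfolding linear_code_iff by (auto simp: block_space_iff)

lemma block_part_carrier: "c \<in> carrier_vec n \<Longrightarrow> block_part N i c \<in> carrier_vec n"
  by (simp add: block_part_def)

lemma block_part_in: "c \<in> carrier_vec (l * N) \<Longrightarrow> block_part N i c \<in> block_space N l i"
  by (auto simp: block_space_iff block_part_def)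

lemma block_part_id: "c \<in> block_space N l i \<Longrightarrow> block_part N i c = c"
  by (auto simp: block_space_iff block_part_def intro!: eq_vecI)

lemma block_part_add: "u \<in> carrier_vec n \<Longrightarrow> v \<in> carrier_vec n \<Longrightarrow>
    block_part N i (u + v :: 'a::field vec) = block_part N i u + block_part N i v"
  by (auto simp: block_part_def intro!: eq_vecI)

lemma block_part_smult: "block_part N i (a \<cdot>\<^sub>v v :: 'a::field vec) = a \<cdot>\<^sub>v block_part N i v"
  by (auto simp: block_part_def intro!: eq_vecI)

lemma block_part_eq_0_iff: "c \<in> carrier_vec n \<Longrightarrow> block_part N i c = 0\<^sub>v n \<longleftrightarrow> i \<notin> block_supp N c"
  by (auto simp: block_part_def block_supp_def vec_eq_iff)

lemma card_block_space:
  assumes "i < l" "N \<ge> 1"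
  shows "card (block_space N l i :: 'a::{field,finite} vec set) = CARD('a) ^ N"
proof -
  define g where "g x = vec (l * N) (\<lambda>k. if k div N = i then x $ (k mod N) else 0)" for x :: "'a vec"
  have "bij_betw (vec_block N i) (block_space N l i) (carrier_vec N :: 'a vec set)"
  proof (rule bij_betw_byWitness[where f' = g])
    show "\<forall>c\<in>block_space N l i. g (vec_block N i c) = c"
      using assms by (auto simp: block_space_iff vec_block_def g_def intro!: eq_vecI)
    show "\<forall>x\<in>carrier_vec N. vec_block N i (g x) = x"
      using assms block_index_less[OF assms(1)] by (auto simp: vec_block_def g_def intro!: eq_vecI)
  qed (auto simp: block_space_iff vec_block_def g_def)
  from bij_betw_same_card[OF this] show ?thesis by (simp add: card_carrier_vec)
qed

text \<open>Links a submatrix acting on short vectors with the whole of \<open>H\<close> acting on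
  vectors that vanish outside block i.\<close>

lemma mat_block_mult:
  assumes "(H :: 'a::field mat) \<in> carrier_mat r (l * N)" "i < l" "N \<ge> 1" "c \<in> carrier_vec (l * N)"
  shows "mat_block N i H *\<^sub>v vec_block N i c = H *\<^sub>v block_part N i c"
proof (rule eq_vecI)
  fix a assume "a < dim_vec (H *\<^sub>v block_part N i c)"
  hence a: "a < r" using assms by simp
  have "(H *\<^sub>v block_part N i c) $ a = (\<Sum>k<l*N. H $$ (a, k) * (if k div N = i then c $ k else 0))"
    using a assms by (auto simp: scalar_prod_def block_part_def lessThan_atLeast0 intro!: sum.cong)
  also have "\<dots> = (\<Sum>k\<in>{k. k < l * N \<and> k div N = i}. H $$ (a, k) * c $ k)"
    by (rule sum.mono_neutral_cong_right) auto
  also have "\<dots> = (\<Sum>b<N. H $$ (a, i * N + b) * c $ (i * N + b))"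
    unfolding block_indices[OF assms(2,3)] by (subst sum.reindex) (auto simp: inj_on_def)
  also have "\<dots> = (mat_block N i H *\<^sub>v vec_block N i c) $ a"
    using a assms by (auto simp: scalar_prod_def mat_block_def vec_block_def lessThan_atLeast0 intro!: sum.cong)
  finally show "(mat_block N i H *\<^sub>v vec_block N i c) $ a = (H *\<^sub>v block_part N i c) $ a" ..
qed (use assms in \<open>auto simp: mat_block_def\<close>)

text \<open>The syndrome of a vector is the sum of the syndromes of its blocks; the coordinatewise
  form avoids sums of vectors.\<close>

lemma mult_eq_sum_blocks:
  assumes "(H :: 'a::field mat) \<in> carrier_mat r (l * N)" "c \<in> carrier_vec (l * N)" "a < r"
  shows "(H *\<^sub>v c) $ a = (\<Sum>i<l. (H *\<^sub>v block_part N i c) $ a)"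
proof -
  have "(\<Sum>i<l. (H *\<^sub>v block_part N i c) $ a)
      = (\<Sum>i<l. \<Sum>k<l*N. if k div N = i then H $$ (a, k) * c $ k else 0)"
    using assms by (auto simp: scalar_prod_def block_part_def lessThan_atLeast0 intro!: sum.cong)
  also have "\<dots> = (\<Sum>k<l*N. \<Sum>i<l. if k div N = i then H $$ (a, k) * c $ k else 0)"
    by (rule sum.swap)
  also have "\<dots> = (\<Sum>k<l*N. H $$ (a, k) * c $ k)"
    by (intro sum.cong refl) (auto simp: div_block_less)
  also have "\<dots> = (H *\<^sub>v c) $ a"
    using assms by (auto simp: scalar_prod_def lessThan_atLeast0 intro!: sum.cong)
  finally show ?thesis ..
qed

lemma Col_mat_block:
  assumes "(H :: 'a::field mat) \<in> carrier_mat r (l * N)" "i < l" "N \<ge> 1"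
  shows "Col (mat_block N i H) = (\<lambda>c. H *\<^sub>v c) ` block_space N l i"
proof (intro equalityI subsetI)
  fix y assume "y \<in> Col (mat_block N i H)"
  then obtain x where x: "x \<in> carrier_vec N" "y = mat_block N i H *\<^sub>v x"
    unfolding Col_eq by (auto simp: mat_block_def)
  define c where "c = vec (l * N) (\<lambda>k. if k div N = i then x $ (k mod N) else 0)"
  have "c \<in> block_space N l i" by (auto simp: block_space_iff c_def)
  moreover have "vec_block N i c = x"
    using x assms(3) block_index_less[OF assms(2)] by (auto simp: vec_block_def c_def intro!: eq_vecI)
  ultimately show "y \<in> (\<lambda>c. H *\<^sub>v c) ` block_space N l i"
    using mat_block_mult[OF assms, of c] block_part_id[of c] x by (auto simp: block_space_def)
next
  fix y assume "y \<in> (\<lambda>c. H *\<^sub>v c) ` block_space N l i"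
  then obtain c where c: "c \<in> block_space N l i" "y = H *\<^sub>v c" by auto
  hence "y = mat_block N i H *\<^sub>v vec_block N i c"
    using mat_block_mult[OF assms, of c] block_part_id[of c] by (auto simp: block_space_def)
  thus "y \<in> Col (mat_block N i H)" unfolding Col_eq by (auto simp: mat_block_def vec_block_def)
qed

lemma block_cols_eq:
  assumes "(H :: 'a::field mat) \<in> carrier_mat r (l * N)" "N \<ge> 1"
  shows "block_cols N l H = (\<lambda>i. (\<lambda>c. H *\<^sub>v c) ` block_space N l i) ` {..<l}"
  unfolding block_cols_def using Col_mat_block[OF assms(1) _ assms(2)] by (auto simp: image_iff)

lemma parity_check_iff:
  "parity_check r n C (H :: 'a::{field,finite} mat) \<longleftrightarrow> H \<in> carrier_mat r n \<and>
     (\<lambda>x. H *\<^sub>v x) ` carrier_vec n = carrier_vec r \<and> C = {c \<in> carrier_vec n. H *\<^sub>v c = 0\<^sub>v r}"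
  unfolding parity_check_def using rank_eq_dim_row_iff by metis

section \<open>Invertible matrices over a finite field\<close>

lemma invertible_matE:
  assumes "(A :: 'a::field mat) \<in> carrier_mat n n" "invertible_mat A"
  obtains B where "B \<in> carrier_mat n n" "A * B = 1\<^sub>m n" "B * A = 1\<^sub>m n"
proof -
  obtain B where B: "A * B = 1\<^sub>m n" "B * A = 1\<^sub>m (dim_row B)"
    using assms unfolding invertible_mat_def inverts_mat_def by auto
  have "dim_col B = n" using arg_cong[OF B(1), of dim_col] by simp
  moreover have "dim_row B = n" using arg_cong[OF B(2), of dim_col] assms(1) by simp
  ultimately show ?thesis using that[of B] B by auto
qed

lemma invertible_mat_iff_det:
  assumes "(A :: 'a::field mat) \<in> carrier_mat n n"
  shows "invertible_mat A \<longleftrightarrow> det A \<noteq> 0"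
proof
  assume "invertible_mat A"
  then obtain B where B: "B \<in> carrier_mat n n" "A * B = 1\<^sub>m n" using invertible_matE[OF assms] by metis
  have "det A * det B = 1" using det_mult[OF assms B(1)] B(2) by simp
  thus "det A \<noteq> 0" by auto
next
  assume "det A \<noteq> 0"
  from det_non_zero_imp_unit[OF assms this, of "()"]
  obtain B where "B \<in> carrier_mat n n" "A * B = 1\<^sub>m n" "B * A = 1\<^sub>m n"
    unfolding Units_def ring_mat_def by auto
  thus "invertible_mat A" using assms unfolding invertible_mat_def inverts_mat_def by auto
qed

lemma invertible_mat_iff_surj:
  assumes "A \<in> carrier_mat n n"
  shows "invertible_mat A \<longleftrightarrow> (\<lambda>x. A *\<^sub>v x) ` carrier_vec n = (carrier_vec n :: 'a::{field,finite} vec set)"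
  using vec_space.det_rank_iff[OF assms] rank_eq_dim_row_iff[OF assms] invertible_mat_iff_det[OF assms] by simp

text \<open>A self-map of a finite set is injective exactly when it is surjective, and a linear map
  is injective exactly when its kernel is zero.\<close>

lemma invertible_mat_iff_kernel:
  assumes A: "A \<in> carrier_mat n n"
  shows "invertible_mat A \<longleftrightarrow> (\<forall>x\<in>carrier_vec n. A *\<^sub>v x = 0\<^sub>v n \<longrightarrow> x = (0\<^sub>v n :: 'a::{field,finite} vec))"
proof -
  have im: "(\<lambda>x. A *\<^sub>v x) ` carrier_vec n \<subseteq> carrier_vec n" using A by auto
  have fin: "finite (carrier_vec n :: 'a vec set)" by (rule finite_carrier_vec)
  have "(\<forall>x\<in>carrier_vec n. A *\<^sub>v x = 0\<^sub>v n \<longrightarrow> x = 0\<^sub>v n) \<longleftrightarrow> inj_on (\<lambda>x. A *\<^sub>v x) (carrier_vec n)"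
  proof
    assume k: "\<forall>x\<in>carrier_vec n. A *\<^sub>v x = 0\<^sub>v n \<longrightarrow> x = 0\<^sub>v n"
    show "inj_on (\<lambda>x. A *\<^sub>v x) (carrier_vec n)"
    proof
      fix x y assume xy: "x \<in> carrier_vec n" "y \<in> carrier_vec n" "A *\<^sub>v x = A *\<^sub>v y"
      hence "A *\<^sub>v (x - y) = 0\<^sub>v n" using A by (simp add: mult_mat_vec_diff[OF A])
      thus "x = y" using k xy vec_diff_eq_0_iff[OF xy(1,2)] by simp
    qed
  next
    assume "inj_on (\<lambda>x. A *\<^sub>v x) (carrier_vec n)"
    moreover have "A *\<^sub>v 0\<^sub>v n = 0\<^sub>v n" using A by (intro eq_vecI) auto
    ultimately show "\<forall>x\<in>carrier_vec n. A *\<^sub>v x = 0\<^sub>v n \<longrightarrow> x = 0\<^sub>v n"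
      by (metis inj_onD zero_carrier_vec)
  qed
  thus ?thesis unfolding invertible_mat_iff_surj[OF A]
    using endo_inj_surj[OF fin im] finite_surj_inj[OF fin, of "\<lambda>x. A *\<^sub>v x"] by auto
qed

section \<open>Distance and isometries\<close>

text \<open>The first clause excludes codewords of weight 1 and the second, in its presence,
  codewords of weight 2. Full row rank is kept apart, since it governs the redundancy and not the
  distance.\<close>

definition spread_mat :: "nat \<Rightarrow> nat \<Rightarrow> nat \<Rightarrow> 'a::field mat \<Rightarrow> bool" where
  "spread_mat N r l H \<longleftrightarrow>
     (\<forall>i<l. \<forall>c\<in>block_space N l i. H *\<^sub>v c = 0\<^sub>v r \<longrightarrow> c = 0\<^sub>v (l * N)) \<and>
     (\<forall>i<l. \<forall>j<l. i \<noteq> j \<longrightarrow> (\<lambda>c. H *\<^sub>v c) ` block_space N l i \<inter> (\<lambda>c. H *\<^sub>v c) ` block_space N l j = {0\<^sub>v r})"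

lemma code_dist_ge_iff:
  assumes "C \<subseteq> carrier_vec (l * N)" "N \<ge> 1"
  shows "code_dist N l (C :: 'a::field vec set) \<ge> 3 \<longleftrightarrow>
     (\<forall>c\<in>C. c \<noteq> 0\<^sub>v (l * N) \<longrightarrow> card (block_supp N c) \<ge> 3)"
proof -
  have e: "wt_SR N l c = card (block_supp N c)" if "c \<in> C" for c
    using that assms by (intro wt_SR_eq_card) auto
  show ?thesis unfolding code_dist_def le_INF_iff by (auto simp: e numeral_eq_enat)
qed

lemma zero_in_block_image:
  "(H :: 'a::field mat) \<in> carrier_mat r (l * N) \<Longrightarrow> 0\<^sub>v r \<in> (\<lambda>c. H *\<^sub>v c) ` block_space N l i"
  using linear_codeD(2)[OF linear_code_image[OF _ linear_code_block_space]] by blast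

text \<open>A codeword of weight 1 is a linear dependency inside one block. A codeword of weight 2
  is a difference of two one-block vectors with the same syndrome, which is then a common vector of
  two column spaces.\<close>

lemma spread_mat_iff_dist:
  assumes H: "(H :: 'a::field mat) \<in> carrier_mat r (l * N)" and N: "N \<ge> 1"
  shows "code_dist N l {c \<in> carrier_vec (l * N). H *\<^sub>v c = 0\<^sub>v r} \<ge> 3 \<longleftrightarrow> spread_mat N r l H"
proof -
  let ?C = "{c \<in> carrier_vec (l * N). H *\<^sub>v c = 0\<^sub>v r}" and ?n = "l * N"
  have dist: "code_dist N l ?C \<ge> 3 \<longleftrightarrow> (\<forall>c\<in>?C. c \<noteq> 0\<^sub>v ?n \<longrightarrow> card (block_supp N c) \<ge> 3)"
    by (rule code_dist_ge_iff[OF _ N]) auto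
  show ?thesis unfolding dist
  proof
    assume d: "\<forall>c\<in>?C. c \<noteq> 0\<^sub>v ?n \<longrightarrow> card (block_supp N c) \<ge> 3"
    show "spread_mat N r l H"
      unfolding spread_mat_def
    proof (intro conjI allI impI ballI)
      fix i c assume "i < l" and c: "c \<in> block_space N l i" "H *\<^sub>v c = 0\<^sub>v r"
      hence "block_supp N c \<subseteq> {i}" "c \<in> ?C" by (auto simp: block_space_def)
      moreover from this have "card (block_supp N c) \<le> 1" by (metis card_mono finite.simps is_singletonI is_singleton_altdef)
      ultimately show "c = 0\<^sub>v ?n" using d by force
    next
      fix i j assume ij: "i < l" "j < l" "i \<noteq> j"
      have "y = 0\<^sub>v r" if yc: "c \<in> block_space N l i" "y = H *\<^sub>v c" and yd: "d \<in> block_space N l j" "y = H *\<^sub>v d" for y c d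
      proof -
        have cd: "c \<in> carrier_vec ?n" "d \<in> carrier_vec ?n" "block_supp N c \<subseteq> {i}" "block_supp N d \<subseteq> {j}"
          using yc yd by (auto simp: block_space_def)
        have "H *\<^sub>v (c - d) = 0\<^sub>v r" using mult_mat_vec_diff[OF H cd(1,2)] yc(2) yd(2) H cd by auto
        hence "c - d \<in> ?C" using cd by auto
        moreover have "card (block_supp N (c - d)) \<le> card {i, j}"
          using block_supp_diff[OF cd(1,2), of N] cd by (intro card_mono) auto
        moreover have "card {i, j} = 2" using ij by simp
        ultimately have "c - d = 0\<^sub>v ?n" using d by force
        \<comment> \<open>Now \<open>c\<close> equals \<open>d\<close>, so its support lies in both
          \<open>{i}\<close> and \<open>{j}\<close>.\<close>
        hence "block_supp N c = {}" using vec_diff_eq_0_iff[OF cd(1,2)] cd ij by auto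
        hence "c = 0\<^sub>v ?n" using block_supp_eq_empty_iff cd by blast
        thus ?thesis using yc H by auto
      qed
      thus "(\<lambda>c. H *\<^sub>v c) ` block_space N l i \<inter> (\<lambda>c. H *\<^sub>v c) ` block_space N l j = {0\<^sub>v r}"
        using zero_in_block_image[OF H] by blast
    qed
  next
    assume s: "spread_mat N r l H"
    show "\<forall>c\<in>?C. c \<noteq> 0\<^sub>v ?n \<longrightarrow> card (block_supp N c) \<ge> 3"
    proof (intro ballI impI, rule ccontr)
      fix c assume c: "c \<in> ?C" "c \<noteq> 0\<^sub>v ?n" and "\<not> card (block_supp N c) \<ge> 3"
      moreover have "card (block_supp N c) \<noteq> 0"
        using c block_supp_eq_empty_iff[of c ?n N] finite_block_supp[of N c] by auto
      ultimately consider "card (block_supp N c) = 1" | "card (block_supp N c) = 2" by linarith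
      thus False
      proof cases
        case 1
        then obtain i where i: "block_supp N c = {i}" by (metis card_1_singletonE)
        hence "c \<in> block_space N l i" using c by (auto simp: block_space_def)
        moreover have "i < l" using i block_supp_subset[of c l N] c by auto
        ultimately show False using s c unfolding spread_mat_def by blast
      next
        case 2
        then obtain i j where ij: "block_supp N c = {i, j}" "i \<noteq> j" by (metis card_2_iff)
        have l: "i < l" "j < l" using ij block_supp_subset[of c l N] c by auto
        \<comment> \<open>The sign makes \<open>c\<close> a difference, so that its zero syndrome
          says that \<open>?u\<close> and \<open>?v\<close> have the same syndrome.\<close>
        let ?u = "block_part N i c" and ?v = "(-1) \<cdot>\<^sub>v block_part N j c"
        have u: "?u \<in> block_space N l i" and v: "?v \<in> block_space N l j"
          using block_part_in c linear_codeD(4)[OF linear_code_block_space] by blast+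
        hence uv: "?u \<in> carrier_vec ?n" "?v \<in> carrier_vec ?n" by (auto simp: block_space_def)
        have "c = ?u - ?v"
        proof (intro eq_vecI)
          fix k assume "k < dim_vec (?u - ?v)"
          hence k: "k < ?n" using uv by simp
          show "c $ k = (?u - ?v) $ k"
          proof (cases "c $ k = 0")
            case False
            hence "k div N \<in> block_supp N c" using k c by (auto simp: block_supp_def)
            thus ?thesis using ij k c by (auto simp: block_part_def)
          qed (use k c in \<open>auto simp: block_part_def\<close>)
        qed (use uv c in auto)
        hence "H *\<^sub>v ?u - H *\<^sub>v ?v = 0\<^sub>v r" using mult_mat_vec_diff[OF H uv] c by auto
        hence eq: "H *\<^sub>v ?u = H *\<^sub>v ?v" using vec_diff_eq_0_iff H uv by (metis mult_mat_vec_carrier)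
        hence "H *\<^sub>v ?u \<in> (\<lambda>c. H *\<^sub>v c) ` block_space N l i \<inter> (\<lambda>c. H *\<^sub>v c) ` block_space N l j"
          using imageI[OF u, of "\<lambda>c. H *\<^sub>v c"] imageI[OF v, of "\<lambda>c. H *\<^sub>v c"] by simp
        hence "H *\<^sub>v ?u = 0\<^sub>v r" using s ij l unfolding spread_mat_def by blast
        hence "?u = 0\<^sub>v ?n" using s l u unfolding spread_mat_def by blast
        hence "i \<notin> block_supp N c" using block_part_eq_0_iff c by blast
        thus False using ij by auto
      qed
    qed
  qed
qed

lemma mult_mat_zero_vec: "(M :: 'a::field mat) \<in> carrier_mat m n \<Longrightarrow> M *\<^sub>v 0\<^sub>v n = 0\<^sub>v m"
  by (intro eq_vecI) auto

lemma linear_map_mult_mat: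
  assumes "M \<in> carrier_mat m n"
  shows "linear_map class_ring (module_vec TYPE('a::field) n) (module_vec TYPE('a) m) (\<lambda>x. M *\<^sub>v x)"
  unfolding linear_map_iff using assms
  by (auto simp: mult_add_distrib_mat_vec[OF assms] mult_mat_vec[OF assms])

text \<open>By linearity, preserving distances is the same as preserving weights, with the zero
  vector as second argument. Only on vectors of length \<open>l * N\<close> does \<phi> agree with a
  matrix, whence the hypothesis on \<open>C\<close>.\<close>

lemma SR_isometric_iff:
  assumes N: "N \<ge> 1" and C: "C \<subseteq> carrier_vec (l * N)"
  shows "SR_isometric N l C D \<longleftrightarrow>
    (\<exists>M\<in>carrier_mat (l * N) (l * N).
       (\<forall>c\<in>carrier_vec (l * N). card (block_supp N (M *\<^sub>v c)) = card (block_supp N c)) \<and>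
       D = (\<lambda>c. M *\<^sub>v (c :: 'a::field vec)) ` C)"
    (is "?L \<longleftrightarrow> ?R")
proof
  let ?n = "l * N"
  assume ?L
  then obtain \<phi> where \<phi>: "linear_map class_ring (module_vec TYPE('a) ?n) (module_vec TYPE('a) ?n) \<phi>"
    "\<forall>c \<in> carrier_vec ?n. \<forall>d \<in> carrier_vec ?n. d_SR N l (\<phi> c) (\<phi> d) = d_SR N l c d"
    "D = \<phi> ` C" unfolding SR_isometric_def by blast
  obtain M where M: "M \<in> carrier_mat ?n ?n" "\<And>x. x \<in> carrier_vec ?n \<Longrightarrow> M *\<^sub>v x = \<phi> x"
    by (rule linear_map_mat[OF \<phi>(1)]) blast
  have "card (block_supp N (M *\<^sub>v c)) = card (block_supp N c)" if c: "c \<in> carrier_vec ?n" for c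
  proof -
    have "\<phi> c \<in> carrier_vec ?n" using M(2)[OF c] M(1) c by (metis mult_mat_vec_carrier)
    moreover have "\<phi> (0\<^sub>v ?n) = 0\<^sub>v ?n" using M(2)[of "0\<^sub>v ?n"] mult_mat_zero_vec[OF M(1)] by simp
    ultimately have \<phi>c: "\<phi> c \<in> carrier_vec ?n" "\<phi> (0\<^sub>v ?n) = 0\<^sub>v ?n" by auto
    have "d_SR N l (\<phi> c) (\<phi> (0\<^sub>v ?n)) = d_SR N l c (0\<^sub>v ?n)" using \<phi>(2) c by simp
    hence "wt_SR N l (\<phi> c) = wt_SR N l c" using \<phi>c c by (simp add: d_SR_def)
    thus ?thesis using wt_SR_eq_card N \<phi>c c M(2) by metis
  qed
  moreover have "D = (\<lambda>c. M *\<^sub>v c) ` C"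
    unfolding \<phi>(3) using M(2) C by (intro image_cong) auto
  ultimately show ?R using M(1) by blast
next
  let ?n = "l * N"
  assume ?R
  then obtain M where M: "M \<in> carrier_mat ?n ?n" "D = (\<lambda>c. M *\<^sub>v c) ` C"
    "\<And>c. c \<in> carrier_vec ?n \<Longrightarrow> card (block_supp N (M *\<^sub>v c)) = card (block_supp N c)" by blast
  have "d_SR N l (M *\<^sub>v c) (M *\<^sub>v d) = d_SR N l c d" if "c \<in> carrier_vec ?n" "d \<in> carrier_vec ?n" for c d
    using M(3)[of "c - d"] mult_mat_vec_diff[OF M(1) that] wt_SR_eq_card[OF _ N] M(1) that
    by (metis d_SR_def minus_carrier_vec mult_mat_vec_carrier)
  thus ?L unfolding SR_isometric_def using linear_map_mult_mat[OF M(1)] M(2) by blast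
qed

section \<open>Linear maps that preserve the weight\<close>

lemma block_space_nontrivial:
  assumes "i < l" "N \<ge> 1"
  obtains e :: "'a::field vec" where "e \<in> block_space N l i" "block_supp N e = {i}"
proof
  have k: "i * N < l * N" "i * N div N = i" using assms by auto
  show "unit_vec (l * N) (i * N) \<in> block_space N l i" 
    using k by (auto simp: block_space_iff)
  show "block_supp N (unit_vec (l * N) (i * N) :: 'a vec) = {i}"
    using k by (auto simp: block_supp_def intro!: exI[of _ "i * N"] split: if_splits)
qed

text \<open>A kernel vector has an image of weight 0, so it has weight 0 itself.\<close>

lemma weight_preserving_invertible:
  assumes M: "(M :: 'a::{field,finite} mat) \<in> carrier_mat n n"
    and w: "\<And>c. c \<in> carrier_vec n \<Longrightarrow> card (block_supp N (M *\<^sub>v c)) = card (block_supp N c)"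
  shows "invertible_mat M"
  unfolding invertible_mat_iff_kernel[OF M]
proof (intro ballI impI)
  fix x assume x: "x \<in> carrier_vec n" "M *\<^sub>v x = 0\<^sub>v n"
  have "block_supp N (M *\<^sub>v x) = {}" using block_supp_eq_empty_iff[of "0\<^sub>v n" n N] x(2) by simp
  hence "card (block_supp N (M *\<^sub>v x)) = 0" by (metis card.empty)
  hence "block_supp N x = {}" using w[OF x(1)] finite_block_supp[of N x] by auto
  thus "x = 0\<^sub>v n" using block_supp_eq_empty_iff x(1) by blast
qed

text \<open>Were two nonzero vectors of one block sent to different blocks, their difference would
  have weight at most 1 and an image of weight 2. Hence each block space goes into one block space,
  onto it by cardinality, and injectivity makes the assignment a permutation.\<close>

lemma weight_preserving_blocks:
  assumes M: "(M :: 'a::{field,finite} mat) \<in> carrier_mat (l * N) (l * N)" and N: "N \<ge> 1"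
    and w: "\<And>c. c \<in> carrier_vec (l * N) \<Longrightarrow> card (block_supp N (M *\<^sub>v c)) = card (block_supp N c)"
  shows "(\<lambda>i. (\<lambda>c. M *\<^sub>v c) ` block_space N l i) ` {..<l} = block_space N l ` {..<l}"
proof -
  let ?n = "l * N" and ?V = "\<lambda>i. block_space N l i :: 'a vec set"
  have inv: "invertible_mat M" by (rule weight_preserving_invertible[OF M w])
  obtain B where B: "B \<in> carrier_mat ?n ?n" "B * M = 1\<^sub>m ?n" using invertible_matE[OF M inv] by metis
  have inj: "inj_on (\<lambda>c. M *\<^sub>v c) (carrier_vec ?n)"
    using B M by (intro inj_on_inverseI[where g = "\<lambda>c. B *\<^sub>v c"]) (simp flip: assoc_mult_mat_vec)
  have V: "?V i \<subseteq> carrier_vec ?n" for i by (auto simp: block_space_def)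
  have "\<exists>j<l. (\<lambda>c. M *\<^sub>v c) ` ?V i = ?V j" if i: "i < l" for i
  proof -
    \<comment> \<open>A vector of weight exactly 1 determines the target block j; every other
      \<open>c\<close> of the block is compared with it.\<close>
    obtain e where e: "e \<in> ?V i" "block_supp N e = {i}" using block_space_nontrivial[OF i N] by metis
    hence ec: "e \<in> carrier_vec ?n" using V by blast
    have Mec: "M *\<^sub>v e \<in> carrier_vec ?n" using ec M by auto
    have "card (block_supp N (M *\<^sub>v e)) = 1" using w[OF ec] e by simp
    then obtain j where j: "block_supp N (M *\<^sub>v e) = {j}" by (metis card_1_singletonE)
    have jl: "j < l" using j block_supp_subset[OF Mec] by auto
    have "M *\<^sub>v c \<in> ?V j" if c: "c \<in> ?V i" for c
    proof (rule ccontr)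
      assume no: "M *\<^sub>v c \<notin> ?V j"
      have cc: "c \<in> carrier_vec ?n" using c V by blast
      hence Mc: "M *\<^sub>v c \<in> carrier_vec ?n" using M by auto
      have "block_supp N c \<subseteq> {i}" using c by (auto simp: block_space_def)
      hence "card (block_supp N (M *\<^sub>v c)) \<le> 1"
        unfolding w[OF cc] using card_mono[of "{i}"] by force
      moreover obtain j' where j': "j' \<in> block_supp N (M *\<^sub>v c)" "j' \<noteq> j"
        using no Mc by (auto simp: block_space_def)
      ultimately have s: "block_supp N (M *\<^sub>v c) = {j'}"
        using card_le_Suc0_iff_eq[OF finite_block_supp, of N "M *\<^sub>v c"] by auto
      have "block_supp N (M *\<^sub>v (c - e)) = {j', j}"
        unfolding mult_mat_vec_diff[OF M cc ec] using block_supp_diff_disjoint[OF Mc Mec] s j j' by auto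
      hence "card (block_supp N (c - e)) = 2" using w[of "c - e"] cc ec j'(2) by auto
      moreover have "block_supp N (c - e) \<subseteq> {i}"
        using linear_codeD(5)[OF linear_code_block_space c e(1)] by (auto simp: block_space_def)
      ultimately show False using card_mono[of "{i}" "block_supp N (c - e)"] by auto
    qed
    hence "(\<lambda>c. M *\<^sub>v c) ` ?V i \<subseteq> ?V j" by auto
    moreover have "card ((\<lambda>c. M *\<^sub>v c) ` ?V i) = card (?V j)"
      using card_image[OF inj_on_subset[OF inj V]] card_block_space[OF i N, where 'a='a] card_block_space[OF jl N, where 'a='a]
      by metis
    ultimately have "(\<lambda>c. M *\<^sub>v c) ` ?V i = ?V j"
      using card_subset_eq[OF linear_code_finite[OF linear_code_block_space]] by blast
    thus ?thesis using jl by blast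
  qed
  hence sub: "(\<lambda>i. (\<lambda>c. M *\<^sub>v c) ` ?V i) ` {..<l} \<subseteq> ?V ` {..<l}" by fastforce
  have inj2: "inj_on ?V {..<l}"
  proof
    fix i j assume "i \<in> {..<l}" "j \<in> {..<l}" "?V i = ?V j"
    moreover from this obtain e where "e \<in> ?V i" "block_supp N e = {i}" using block_space_nontrivial N by (metis lessThan_iff)
    ultimately show "i = j" by (auto simp: block_space_def)
  qed
  have "inj_on (\<lambda>i. (\<lambda>c. M *\<^sub>v c) ` ?V i) {..<l}"
  proof
    fix i j assume ij: "i \<in> {..<l}" "j \<in> {..<l}" "(\<lambda>c. M *\<^sub>v c) ` ?V i = (\<lambda>c. M *\<^sub>v c) ` ?V j"
    hence "?V i = ?V j" using inj_on_image_eq_iff[OF inj V V] by blast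
    thus "i = j" using inj2 ij by (auto dest: inj_onD)
  qed
  \<comment> \<open>Both families have l members, so the inclusion \<open>sub\<close> is an
    equality.\<close>
  with inj2 have "card ((\<lambda>i. (\<lambda>c. M *\<^sub>v c) ` ?V i) ` {..<l}) = card (?V ` {..<l})"
    by (simp add: card_image)
  with sub show ?thesis by (intro card_subset_eq) auto
qed

lemma spread_mat_disjoint:
  "spread_mat N r l H \<Longrightarrow> i < l \<Longrightarrow> j < l \<Longrightarrow> i \<noteq> j \<Longrightarrow>
     (\<lambda>c. H *\<^sub>v c) ` block_space N l i \<inter> (\<lambda>c. H *\<^sub>v c) ` block_space N l j = {0\<^sub>v r}"
  by (simp add: spread_mat_def)

text \<open>Surjectivity onto q^r vectors fixes the size of the kernel, so the redundancy condition
  holds automatically and only the distance remains.\<close>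

lemma SR_code3_iff_spread_mat:
  assumes H: "(H :: 'a::{field,finite} mat) \<in> carrier_mat r (l * N)" and N: "N \<ge> 1"
    and surj: "(\<lambda>x. H *\<^sub>v x) ` carrier_vec (l * N) = carrier_vec r"
    and C: "C = {c \<in> carrier_vec (l * N). H *\<^sub>v c = 0\<^sub>v r}"
  shows "SR_code3 N r l C \<longleftrightarrow> spread_mat N r l H"
proof -
  have lin: "linear_code (l * N) C" unfolding C by (rule linear_code_kernel[OF H])
  have "CARD('a) ^ (l * N) = CARD('a) ^ r * card C"
    using card_image_kernel[OF H linear_code_carrier] by (simp add: surj card_carrier_vec C)
  hence "CARD('a) ^ (l * N) = CARD('a) ^ (r + subspace_dim (l * N) C)"
    by (simp add: card_linear_code[OF lin] power_add)
  hence "r + subspace_dim (l * N) C = l * N" using field_card_gt_1[where 'a='a] by simp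
  thus ?thesis using spread_mat_iff_dist[OF H N] lin unfolding SR_code3_def C by simp
qed

lemma parity_check_spread_mat:
  assumes "SR_code3 N r l C" "parity_check r (l * N) C H" "N \<ge> 1"
  shows "spread_mat N r l (H :: 'a::{field,finite} mat)"
  using assms SR_code3_iff_spread_mat[of H r l N C] by (simp add: parity_check_iff)

section \<open>Parity-check matrices up to a left factor\<close>

lemma image_compose_mult:
  assumes "A \<in> carrier_mat m r" "H \<in> carrier_mat r n" "W \<subseteq> carrier_vec n"
  shows "(\<lambda>x. (A * H) *\<^sub>v x) ` W = (\<lambda>v. A *\<^sub>v v) ` (\<lambda>x. H *\<^sub>v (x :: 'a::field vec)) ` W"
  unfolding image_image using assms by (intro image_cong) auto

lemma parity_check_mult_left:
  assumes "parity_check r n C (H :: 'a::{field,finite} mat)" "A \<in> carrier_mat r r" "invertible_mat A"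
  shows "parity_check r n C (A * H)"
proof -
  have H: "H \<in> carrier_mat r n" "(\<lambda>x. H *\<^sub>v x) ` carrier_vec n = carrier_vec r"
    "C = {c \<in> carrier_vec n. H *\<^sub>v c = 0\<^sub>v r}" using assms(1) unfolding parity_check_iff by auto
  have "(A * H) *\<^sub>v c = 0\<^sub>v r \<longleftrightarrow> H *\<^sub>v c = 0\<^sub>v r" if c: "c \<in> carrier_vec n" for c
  proof -
    have "(A * H) *\<^sub>v c = A *\<^sub>v (H *\<^sub>v c)" using H(1) assms(2) c by auto
    moreover have "H *\<^sub>v c \<in> carrier_vec r" using H(1) c by auto
    ultimately show ?thesis
      using invertible_mat_iff_kernel[OF assms(2)] assms(3) mult_mat_zero_vec[OF assms(2)] by metis
  qed
  hence "C = {c \<in> carrier_vec n. (A * H) *\<^sub>v c = 0\<^sub>v r}" unfolding H(3) by auto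
  moreover have "(\<lambda>x. (A * H) *\<^sub>v x) ` carrier_vec n = carrier_vec r"
    using image_compose_mult[OF assms(2) H(1)] H(2) assms(3) invertible_mat_iff_surj[OF assms(2)] by simp
  ultimately show ?thesis unfolding parity_check_iff using H(1) assms(2) by auto
qed

lemma block_cols_mult_left:
  assumes "A \<in> carrier_mat r r" "(H :: 'a::field mat) \<in> carrier_mat r (l * N)" "N \<ge> 1"
  shows "block_cols N l (A * H) = (\<lambda>U. (\<lambda>v. A *\<^sub>v v) ` U) ` block_cols N l H"
proof -
  have "(\<lambda>c. (A * H) *\<^sub>v c) ` block_space N l i = (\<lambda>v. A *\<^sub>v v) ` (\<lambda>c. H *\<^sub>v c) ` block_space N l i" for i
    by (rule image_compose_mult[OF assms(1,2)]) (auto simp: block_space_def)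
  thus ?thesis using assms by (subst (1 2) block_cols_eq[of _ r]) (auto simp: image_image)
qed

lemma right_inverse_mat:
  assumes "(L :: 'a::field mat) \<in> carrier_mat r n" "(\<lambda>x. L *\<^sub>v x) ` carrier_vec n = carrier_vec r"
  obtains R where "R \<in> carrier_mat n r" "\<And>y. y \<in> carrier_vec r \<Longrightarrow> L *\<^sub>v (R *\<^sub>v y) = y"
proof -
  have "\<exists>x\<in>carrier_vec n. L *\<^sub>v x = unit_vec r i" for i
    using assms(2) unit_vec_carrier[of r i] by (metis imageE)
  then obtain f where f: "f i \<in> carrier_vec n" "L *\<^sub>v f i = unit_vec r i" for i by metis
  define R where "R = mat_of_cols n (map f [0..<r])"
  have R: "R \<in> carrier_mat n r" by (simp add: R_def mat_of_cols_def)
  have "L * R = 1\<^sub>m r"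
  proof (intro mat_col_eqI)
    fix i assume "i < dim_col (1\<^sub>m r :: 'a mat)"
    hence i: "i < r" by simp
    have "col (L * R) i = L *\<^sub>v col R i" using i by (metis R assms(1) carrier_matD(2) col_mult2)
    also have "col R i = f i" using i f by (simp add: R_def)
    finally show "col (L * R) i = col (1\<^sub>m r) i" using f i by simp
  qed (use assms R in auto)
  hence "L *\<^sub>v (R *\<^sub>v y) = y" if "y \<in> carrier_vec r" for y
    using that assms(1) R by (metis assoc_mult_mat_vec one_mult_mat_vec)
  thus ?thesis using that R by blast
qed

text \<open>With a right inverse \<open>R\<close> of \<open>L\<close> the factor must be
  \<open>L' * R\<close>. It works because x - R L x lies in the kernel of \<open>L\<close>, which is
  \<open>C\<close> and thus also the kernel of \<open>L'\<close>. The factor is invertible because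
  \<open>L'\<close> is surjective.\<close>

lemma parity_check_unique:
  assumes "parity_check r n C (L :: 'a::{field,finite} mat)" "parity_check r n C L'"
  obtains A where "A \<in> carrier_mat r r" "invertible_mat A" "L' = A * L"
proof -
  have L: "L \<in> carrier_mat r n" "(\<lambda>x. L *\<^sub>v x) ` carrier_vec n = carrier_vec r"
    "C = {c \<in> carrier_vec n. L *\<^sub>v c = 0\<^sub>v r}" using assms(1) unfolding parity_check_iff by auto
  have L': "L' \<in> carrier_mat r n" "(\<lambda>x. L' *\<^sub>v x) ` carrier_vec n = carrier_vec r"
    "C = {c \<in> carrier_vec n. L' *\<^sub>v c = 0\<^sub>v r}" using assms(2) unfolding parity_check_iff by auto
  obtain R where R: "R \<in> carrier_mat n r" "\<And>y. y \<in> carrier_vec r \<Longrightarrow> L *\<^sub>v (R *\<^sub>v y) = y"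
    using right_inverse_mat[OF L(1,2)] by metis
  define A where "A = L' * R"
  have A: "A \<in> carrier_mat r r" unfolding A_def using L' R by auto
  have eq: "(A * L) *\<^sub>v x = L' *\<^sub>v x" if x: "x \<in> carrier_vec n" for x
  proof -
    define z where "z = R *\<^sub>v (L *\<^sub>v x)"
    have Lx: "L *\<^sub>v x \<in> carrier_vec r" using L(1) x by auto
    have z: "z \<in> carrier_vec n" unfolding z_def using R(1) Lx by auto
    have "L *\<^sub>v (x - z) = 0\<^sub>v r"
      unfolding mult_mat_vec_diff[OF L(1) x z] unfolding z_def R(2)[OF Lx] using Lx by auto
    hence "x - z \<in> C" using L(3) x z by auto
    hence "L' *\<^sub>v (x - z) = 0\<^sub>v r" using L'(3) by auto
    hence "L' *\<^sub>v x = L' *\<^sub>v z"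
      unfolding mult_mat_vec_diff[OF L'(1) x z] using vec_diff_eq_0_iff L'(1) x z by (metis mult_mat_vec_carrier)
    also have "\<dots> = A *\<^sub>v (L *\<^sub>v x)" unfolding z_def A_def using L'(1) R(1) Lx by auto
    also have "\<dots> = (A * L) *\<^sub>v x" using A L(1) x by auto
    finally show ?thesis ..
  qed
  have AL: "A * L = L'"
  proof (intro mat_col_eqI)
    fix i assume "i < dim_col L'"
    hence i: "i < n" using L'(1) by simp
    have "M *\<^sub>v unit_vec n i = col M i" if "M \<in> carrier_mat r n" for M :: "'a mat"
      using that i by (intro eq_vecI) (auto simp: scalar_prod_right_unit)
    thus "col (A * L) i = col L' i" using eq[of "unit_vec n i"] A L(1) L'(1) by (metis mult_carrier_mat unit_vec_carrier)
  qed (use A L(1) L'(1) in auto)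
  have "carrier_vec r = (\<lambda>v. A *\<^sub>v v) ` carrier_vec r"
    using image_compose_mult[OF A L(1), of "carrier_vec n"] L'(2) L(2) unfolding AL by auto
  hence "invertible_mat A" using invertible_mat_iff_surj[OF A] by simp
  with A AL that show ?thesis by metis
qed

lemma spread_mat_inj:
  assumes "(H :: 'a::field mat) \<in> carrier_mat r (l * N)" "spread_mat N r l H" "i < l"
  shows "inj_on (\<lambda>c. H *\<^sub>v c) (block_space N l i)"
proof
  fix c d assume cd: "c \<in> block_space N l i" "d \<in> block_space N l i" "H *\<^sub>v c = H *\<^sub>v d"
  hence car: "c \<in> carrier_vec (l * N)" "d \<in> carrier_vec (l * N)" by (auto simp: block_space_def)
  have "H *\<^sub>v (c - d) = 0\<^sub>v r" using mult_mat_vec_diff[OF assms(1) car] cd(3) assms(1) car by auto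
  moreover have "c - d \<in> block_space N l i" using linear_codeD(5)[OF linear_code_block_space] cd by blast
  ultimately have "c - d = 0\<^sub>v (l * N)" using assms(2,3) unfolding spread_mat_def by blast
  thus "c = d" using vec_diff_eq_0_iff[OF car] by simp
qed

lemma card_block_image:
  assumes "(H :: 'a::{field,finite} mat) \<in> carrier_mat r (l * N)" "spread_mat N r l H" "i < l" "N \<ge> 1"
  shows "card ((\<lambda>c. H *\<^sub>v c) ` block_space N l i) = CARD('a) ^ N"
  using card_image[OF spread_mat_inj[OF assms(1-3)]] card_block_space[OF assms(3,4), where 'a='a] by simp

text \<open>Equal column spaces at different positions would meet trivially and so be zero, whereas
  \<open>N \<ge> 1\<close> gives each of them more than one element.\<close>

lemma spread_mat_inj_blocks:
  assumes "(H :: 'a::{field,finite} mat) \<in> carrier_mat r (l * N)" "spread_mat N r l H" "N \<ge> 1"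
  shows "inj_on (\<lambda>i. (\<lambda>c. H *\<^sub>v c) ` block_space N l i) {..<l}"
proof (rule inj_onI, rule ccontr)
  fix i j assume ij: "i \<in> {..<l}" "j \<in> {..<l}"
    "(\<lambda>c. H *\<^sub>v c) ` block_space N l i = (\<lambda>c. H *\<^sub>v c) ` block_space N l j" "i \<noteq> j"
  moreover have "(\<lambda>c. H *\<^sub>v c) ` block_space N l i \<inter> (\<lambda>c. H *\<^sub>v c) ` block_space N l j = {0\<^sub>v r}"
    by (rule spread_mat_disjoint[OF assms(2)]) (use ij in auto)
  ultimately have "(\<lambda>c. H *\<^sub>v c) ` block_space N l i = {0\<^sub>v r}" by simp
  hence "CARD('a) ^ N = 1" using card_block_image[OF assms(1,2) _ assms(3), of i] ij by simp
  moreover have "CARD('a) ^ N > 1" using one_less_power[OF field_card_gt_1[where 'a='a], of N] assms(3) by simp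
  ultimately show False by linarith
qed

text \<open>With \<open>\<sigma>\<close> matching equal column spaces, the isometry sends c to the vector d whose block
  \<open>\<sigma> i\<close> has the same syndrome under L as block i of c has under H.\<close>

lemma block_cols_eq_imp_isometric:
  assumes N: "N \<ge> 1" and pc: "parity_check r (l * N) C (H :: 'a::{field,finite} mat)" and pd: "parity_check r (l * N) D L"
    and sH: "spread_mat N r l H" and sL: "spread_mat N r l L"
    and eq: "block_cols N l H = block_cols N l L"
  shows "SR_isometric N l C D"
proof -
  let ?n = "l * N" and ?V = "\<lambda>i. block_space N l i :: 'a vec set"
  let ?HV = "\<lambda>i. (\<lambda>c. H *\<^sub>v c) ` ?V i" and ?LV = "\<lambda>i. (\<lambda>c. L *\<^sub>v c) ` ?V i"
  have H: "H \<in> carrier_mat r ?n" "C = {c \<in> carrier_vec ?n. H *\<^sub>v c = 0\<^sub>v r}" using pc unfolding parity_check_iff by auto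
  have L: "L \<in> carrier_mat r ?n" "D = {c \<in> carrier_vec ?n. L *\<^sub>v c = 0\<^sub>v r}" using pd unfolding parity_check_iff by auto
  have eqV: "?HV ` {..<l} = ?LV ` {..<l}" using eq block_cols_eq[OF H(1) N] block_cols_eq[OF L(1) N] by simp
  \<comment> \<open>Both matrices list the same column spaces without repetition, so matching them
    permutes the positions.\<close>
  define \<sigma> where "\<sigma> = the_inv_into {..<l} ?LV \<circ> ?HV"
  have injH: "inj_on ?HV {..<l}" by (rule spread_mat_inj_blocks[OF H(1) sH N])
  have injL: "inj_on ?LV {..<l}" by (rule spread_mat_inj_blocks[OF L(1) sL N])
  have "bij_betw ?HV {..<l} (?LV ` {..<l})" using injH eqV by (auto simp: bij_betw_def)
  moreover have "bij_betw (the_inv_into {..<l} ?LV) (?LV ` {..<l}) {..<l}"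
    using injL by (intro bij_betw_the_inv_into) (auto simp: bij_betw_def)
  ultimately have \<sigma>: "bij_betw \<sigma> {..<l} {..<l}" unfolding \<sigma>_def by (rule bij_betw_trans)
  have \<sigma>l: "\<sigma> i < l" if "i < l" for i using \<sigma> that by (auto simp: bij_betw_def)
  have \<sigma>V: "?HV i = ?LV (\<sigma> i)" if "i < l" for i
    unfolding \<sigma>_def using f_the_inv_into_f[OF injL, of "?HV i"] eqV that by (metis comp_apply imageI lessThan_iff)
  define \<tau> where "\<tau> = inv_into {..<l} \<sigma>"
  have \<tau>: "\<tau> j < l" "\<sigma> (\<tau> j) = j" if "j < l" for j
    using that bij_betw_inv_into_right[OF \<sigma>] bij_betw_apply[OF bij_betw_inv_into[OF \<sigma>], of j]
    by (auto simp: \<tau>_def)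
  \<comment> \<open>The isometry as a relation: \<open>d\<close> exists since the column spaces
    match, and is unique since each block of \<open>L\<close> has full column rank.\<close>
  define S where "S c d \<longleftrightarrow> d \<in> carrier_vec ?n \<and>
     (\<forall>i<l. L *\<^sub>v block_part N (\<sigma> i) d = H *\<^sub>v block_part N i c)" for c d
  have ex: "\<exists>d. S c d" if c: "c \<in> carrier_vec ?n" for c
  proof -
    have "\<forall>i<l. \<exists>y\<in>?V (\<sigma> i). L *\<^sub>v y = H *\<^sub>v block_part N i c"
      using \<sigma>V block_part_in[OF c] by (metis (no_types, lifting) imageE imageI)
    then obtain y where y: "\<And>i. i < l \<Longrightarrow> y i \<in> ?V (\<sigma> i) \<and> L *\<^sub>v y i = H *\<^sub>v block_part N i c" by metis
    \<comment> \<open>The solutions found for the single blocks are glued; block j of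
      \<open>d\<close> comes from block \<open>\<tau> j\<close> of \<open>c\<close>.\<close>
    define d where "d = vec ?n (\<lambda>k. y (\<tau> (k div N)) $ k)"
    have "block_part N (\<sigma> i) d = y i" if i: "i < l" for i
    proof -
      have "\<tau> (\<sigma> i) = i" using \<tau>[OF \<sigma>l[OF i]] \<sigma> i unfolding bij_betw_def by (auto dest: inj_onD)
      thus ?thesis using y[OF i] by (auto simp: block_part_def d_def block_space_iff intro!: eq_vecI)
    qed
    hence "S c d" unfolding S_def using y by (auto simp: d_def)
    thus ?thesis by blast
  qed
  \<comment> \<open>Full column rank on both sides makes a block vanish exactly when its syndrome
    does, so \<sigma> carries one support to the other.\<close>
  have uniq: "block_supp N d = \<sigma> ` block_supp N c" if c: "c \<in> carrier_vec ?n" and S: "S c d" for c d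
  proof -
    have d: "d \<in> carrier_vec ?n" using S unfolding S_def by simp
    have iff: "\<sigma> i \<notin> block_supp N d \<longleftrightarrow> i \<notin> block_supp N c" if i: "i < l" for i
    proof -
      have "\<sigma> i \<notin> block_supp N d \<longleftrightarrow> L *\<^sub>v block_part N (\<sigma> i) d = 0\<^sub>v r"
        unfolding block_part_eq_0_iff[OF d, symmetric]
        using sL \<sigma>l[OF i] block_part_in[OF d] mult_mat_zero_vec[OF L(1)] unfolding spread_mat_def by metis
      also have "\<dots> \<longleftrightarrow> H *\<^sub>v block_part N i c = 0\<^sub>v r" using S i unfolding S_def by simp
      also have "\<dots> \<longleftrightarrow> i \<notin> block_supp N c"
        unfolding block_part_eq_0_iff[OF c, symmetric]
        using sH i block_part_in[OF c] mult_mat_zero_vec[OF H(1)] unfolding spread_mat_def by metis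
      finally show ?thesis .
    qed
    show ?thesis
    proof (intro equalityI subsetI)
      fix j assume j: "j \<in> block_supp N d"
      hence "j < l" using block_supp_subset[OF d] by auto
      hence "\<tau> j \<in> block_supp N c" "\<sigma> (\<tau> j) = j" using iff[of "\<tau> j"] \<tau> j by auto
      thus "j \<in> \<sigma> ` block_supp N c" by (metis imageI)
    next
      fix j assume "j \<in> \<sigma> ` block_supp N c"
      then obtain i where i: "i \<in> block_supp N c" "j = \<sigma> i" by blast
      moreover from this have "i < l" using block_supp_subset[OF c] by auto
      ultimately show "j \<in> block_supp N d" using iff by blast
    qed
  qed
  have S_diff: "S (c - c') (d - d')" if "c \<in> carrier_vec ?n" "c' \<in> carrier_vec ?n" "S c d" "S c' d'" for c c' d d'
  proof -
    have bd: "block_part N i (u - v) = block_part N i u - block_part N i v"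
      if "u \<in> carrier_vec ?n" "v \<in> carrier_vec ?n" for i and u v :: "'a vec"
      using that by (auto simp: block_part_def intro!: eq_vecI)
    have "d \<in> carrier_vec ?n" "d' \<in> carrier_vec ?n" using that by (auto simp: S_def)
    thus ?thesis using that unfolding S_def
      by (simp add: bd mult_mat_vec_diff[OF L(1)] mult_mat_vec_diff[OF H(1)] block_part_carrier)
  qed
  have S_uniq: "d = d'" if "c \<in> carrier_vec ?n" "S c d" "S c d'" for c d d'
  proof -
    \<comment> \<open>By linearity \<open>d - d'\<close> is related to the zero vector, so its
      support is empty.\<close>
    have "block_supp N (d - d') = \<sigma> ` block_supp N (c - c)"
      using uniq[OF _ S_diff[OF that(1,1,2,3)]] that(1) by auto
    also have "c - c = 0\<^sub>v ?n" using that(1) by auto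
    also have "block_supp N (0\<^sub>v ?n :: 'a vec) = {}" using block_supp_eq_empty_iff[of "0\<^sub>v ?n" ?n N] by simp
    finally have "d - d' = 0\<^sub>v ?n" using block_supp_eq_empty_iff[of "d - d'" ?n N] that by (simp add: S_def)
    thus ?thesis using vec_diff_eq_0_iff that unfolding S_def by blast
  qed
  define \<phi> where "\<phi> c = (THE d. S c d)" for c
  have \<phi>: "S c (\<phi> c)" if "c \<in> carrier_vec ?n" for c
  proof -
    have "\<exists>!d. S c d" using ex[OF that] S_uniq[OF that] by blast
    thus ?thesis unfolding \<phi>_def by (rule theI')
  qed
  have \<phi>_eq: "\<phi> c = d" if "c \<in> carrier_vec ?n" "S c d" for c d by (rule S_uniq[OF that(1) \<phi>[OF that(1)] that(2)])
  have \<phi>c: "\<phi> c \<in> carrier_vec ?n" if "c \<in> carrier_vec ?n" for c using \<phi>[OF that] by (simp add: S_def)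
  have lin: "linear_map class_ring (module_vec TYPE('a) ?n) (module_vec TYPE('a) ?n) \<phi>"
    unfolding linear_map_iff
  proof (intro conjI allI ballI)
    fix u :: "'a vec" assume u: "u \<in> carrier_vec ?n"
    show "\<phi> u \<in> carrier_vec ?n" using \<phi>c[OF u] .
    fix a :: 'a show "\<phi> (a \<cdot>\<^sub>v u) = a \<cdot>\<^sub>v \<phi> u"
      using \<phi>[OF u] u by (intro \<phi>_eq)
        (auto simp: S_def block_part_smult mult_mat_vec[OF L(1)] mult_mat_vec[OF H(1)] block_part_carrier)
  next
    fix u v :: "'a vec" assume uv: "u \<in> carrier_vec ?n" "v \<in> carrier_vec ?n"
    show "\<phi> (u + v) = \<phi> u + \<phi> v"
      using \<phi>[OF uv(1)] \<phi>[OF uv(2)] uv by (intro \<phi>_eq)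
        (auto simp: S_def block_part_add mult_add_distrib_mat_vec[OF L(1)] mult_add_distrib_mat_vec[OF H(1)] block_part_carrier)
  qed
  obtain M where M: "M \<in> carrier_mat ?n ?n" "\<And>c. c \<in> carrier_vec ?n \<Longrightarrow> M *\<^sub>v c = \<phi> c"
    by (rule linear_map_mat[OF lin]) blast
  have w: "card (block_supp N (M *\<^sub>v c)) = card (block_supp N c)" if c: "c \<in> carrier_vec ?n" for c
  proof -
    have "inj_on \<sigma> (block_supp N c)" using \<sigma> block_supp_subset[OF c] by (auto simp: bij_betw_def intro: inj_on_subset)
    thus ?thesis unfolding M(2)[OF c] uniq[OF c \<phi>[OF c]] by (rule card_image)
  qed
  \<comment> \<open>Summed over the blocks, the local matching shows that \<open>M\<close> preserves
    the total syndrome, hence membership in the codes.\<close>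
  have syn: "L *\<^sub>v (M *\<^sub>v c) = H *\<^sub>v c" if c: "c \<in> carrier_vec ?n" for c
  proof (rule eq_vecI)
    fix a assume "a < dim_vec (H *\<^sub>v c)"
    hence a: "a < r" using H(1) by simp
    have "(L *\<^sub>v \<phi> c) $ a = (\<Sum>j<l. (L *\<^sub>v block_part N j (\<phi> c)) $ a)"
      by (rule mult_eq_sum_blocks[OF L(1) \<phi>c[OF c] a])
    also have "\<dots> = (\<Sum>i<l. (L *\<^sub>v block_part N (\<sigma> i) (\<phi> c)) $ a)"
      by (rule sum.reindex_bij_betw[OF \<sigma>, symmetric])
    also have "\<dots> = (\<Sum>i<l. (H *\<^sub>v block_part N i c) $ a)"
      using \<phi>[OF c] by (simp add: S_def)
    also have "\<dots> = (H *\<^sub>v c) $ a" by (rule mult_eq_sum_blocks[OF H(1) c a, symmetric])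
    finally show "(L *\<^sub>v (M *\<^sub>v c)) $ a = (H *\<^sub>v c) $ a" unfolding M(2)[OF c] .
  qed (use L(1) H(1) in auto)
  have surjM: "(\<lambda>x. M *\<^sub>v x) ` carrier_vec ?n = carrier_vec ?n"
    using weight_preserving_invertible[OF M(1) w] invertible_mat_iff_surj[OF M(1)] by simp
  have "D = (\<lambda>c. M *\<^sub>v c) ` C"
  proof (intro equalityI subsetI)
    fix d assume d: "d \<in> D"
    hence "d \<in> carrier_vec ?n" using L(2) by simp
    then obtain c where c: "c \<in> carrier_vec ?n" "d = M *\<^sub>v c" using surjM by blast
    hence "c \<in> C" using d syn[OF c(1)] H(2) L(2) by auto
    thus "d \<in> (\<lambda>c. M *\<^sub>v c) ` C" using c by blast
  next
    fix d assume "d \<in> (\<lambda>c. M *\<^sub>v c) ` C"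
    then obtain c where "c \<in> C" "d = M *\<^sub>v c" by blast
    thus "d \<in> D" using syn[of c] H(2) L(2) M(1) by auto
  qed
  thus ?thesis using M(1) w SR_isometric_iff[OF N, of C l D] H(2) by blast
qed

text \<open>If \<open>M\<close> realises the isometry, then \<open>H\<close> times the inverse of
  \<open>M\<close> is a parity-check matrix of \<open>D\<close>. Since \<open>M\<close> permutes the
  block spaces, the new matrix has the column spaces of \<open>H\<close>, possibly in another
  order.\<close>

lemma isometric_imp_parity_check:
  assumes N: "N \<ge> 1" and pc: "parity_check r (l * N) C (H :: 'a::{field,finite} mat)"
    and iso: "SR_isometric N l C D"
  obtains L' where "parity_check r (l * N) D L'" "block_cols N l L' = block_cols N l H"
proof -
  let ?n = "l * N" and ?V = "\<lambda>i. block_space N l i :: 'a vec set"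
  have H: "H \<in> carrier_mat r ?n" "(\<lambda>x. H *\<^sub>v x) ` carrier_vec ?n = carrier_vec r"
    "C = {c \<in> carrier_vec ?n. H *\<^sub>v c = 0\<^sub>v r}" using pc unfolding parity_check_iff by auto
  have C: "C \<subseteq> carrier_vec ?n" using H(3) by auto
  obtain M where M: "M \<in> carrier_mat ?n ?n" "D = (\<lambda>c. M *\<^sub>v c) ` C"
    and w: "\<And>c. c \<in> carrier_vec ?n \<Longrightarrow> card (block_supp N (M *\<^sub>v c)) = card (block_supp N c)"
    using iso unfolding SR_isometric_iff[OF N C] by blast
  have inv: "invertible_mat M" by (rule weight_preserving_invertible[OF M(1) w])
  obtain P where P: "P \<in> carrier_mat ?n ?n" "M * P = 1\<^sub>m ?n" "P * M = 1\<^sub>m ?n"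
    using invertible_matE[OF M(1) inv] by metis
  have MP: "M *\<^sub>v (P *\<^sub>v x) = x" and PM: "P *\<^sub>v (M *\<^sub>v x) = x" if "x \<in> carrier_vec ?n" for x
    using that P M(1) by (metis assoc_mult_mat_vec one_mult_mat_vec)+
  have P_surj: "(\<lambda>x. P *\<^sub>v x) ` carrier_vec ?n = carrier_vec ?n"
    using PM M(1) P(1) by (auto simp: image_iff) (metis mult_mat_vec_carrier)
  define L' where "L' = H * P"
  have L': "L' \<in> carrier_mat r ?n" unfolding L'_def using H(1) P(1) by auto
  have L'x: "L' *\<^sub>v x = H *\<^sub>v (P *\<^sub>v x)" if "x \<in> carrier_vec ?n" for x
    unfolding L'_def using H(1) P(1) that by auto
  have "D = {d \<in> carrier_vec ?n. L' *\<^sub>v d = 0\<^sub>v r}"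
  proof (intro equalityI subsetI)
    fix d assume "d \<in> D"
    then obtain c where c: "c \<in> C" "d = M *\<^sub>v c" using M(2) by blast
    hence "c \<in> carrier_vec ?n" using C by blast
    thus "d \<in> {d \<in> carrier_vec ?n. L' *\<^sub>v d = 0\<^sub>v r}" using c L'x PM M(1) H(3) by auto
  next
    fix d assume "d \<in> {d \<in> carrier_vec ?n. L' *\<^sub>v d = 0\<^sub>v r}"
    hence d: "d \<in> carrier_vec ?n" "H *\<^sub>v (P *\<^sub>v d) = 0\<^sub>v r" using L'x by auto
    hence "P *\<^sub>v d \<in> C" using H(3) P(1) by auto
    thus "d \<in> D" using MP[OF d(1)] M(2) by (metis imageI)
  qed
  moreover have "(\<lambda>x. L' *\<^sub>v x) ` carrier_vec ?n = carrier_vec r"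
    unfolding L'_def using image_compose_mult[OF H(1) P(1), of "carrier_vec ?n"] P_surj H(2) by simp
  ultimately have pd: "parity_check r ?n D L'" unfolding parity_check_iff using L' by auto
  have sub: "?V i \<subseteq> carrier_vec ?n" for i by (auto simp: block_space_def)
  have bl: "(\<lambda>i. (\<lambda>c. M *\<^sub>v c) ` ?V i) ` {..<l} = ?V ` {..<l}"
    by (rule weight_preserving_blocks[OF M(1) N w])
  have inner: "(\<lambda>c. L' *\<^sub>v c) ` (\<lambda>c. M *\<^sub>v c) ` ?V i = (\<lambda>c. H *\<^sub>v c) ` ?V i" for i
    unfolding image_image using sub[of i] M(1) by (intro image_cong refl) (auto simp: L'x PM subset_iff)
  have "block_cols N l L' = (\<lambda>W. (\<lambda>c. L' *\<^sub>v c) ` W) ` ?V ` {..<l}"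
    using block_cols_eq[OF L' N] by (simp add: image_image)
  also have "\<dots> = (\<lambda>i. (\<lambda>c. H *\<^sub>v c) ` ?V i) ` {..<l}"
    unfolding bl[symmetric] by (simp only: image_image[of "\<lambda>W. (\<lambda>c. L' *\<^sub>v c) ` W"] inner)
  also have "\<dots> = block_cols N l H" using block_cols_eq[OF H(1) N] by simp
  finally show ?thesis using that pd by blast
qed

lemma GL_equivalent_sym:
  assumes "GL_equivalent r S (T :: 'a::{field,finite} vec set set)" "\<And>U. U \<in> S \<Longrightarrow> U \<subseteq> carrier_vec r"
  shows "GL_equivalent r T S"
proof -
  obtain A where A: "A \<in> carrier_mat r r" "invertible_mat A" "T = (\<lambda>U. (\<lambda>v. A *\<^sub>v v) ` U) ` S"
    using assms(1) unfolding GL_equivalent_def by blast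
  obtain B where B: "B \<in> carrier_mat r r" "A * B = 1\<^sub>m r" "B * A = 1\<^sub>m r" using invertible_matE[OF A(1,2)] by metis
  have "(\<lambda>v. B *\<^sub>v v) ` (\<lambda>v. A *\<^sub>v v) ` U = U" if "U \<in> S" for U
  proof -
    have "(\<lambda>v. B *\<^sub>v v) ` (\<lambda>v. A *\<^sub>v v) ` U = (\<lambda>x. (B * A) *\<^sub>v x) ` U"
      using image_compose_mult[OF B(1) A(1) assms(2)[OF that]] by simp
    also have "\<dots> = (\<lambda>x. x) ` U" using assms(2)[OF that] unfolding B(3) by (intro image_cong) auto
    finally show ?thesis by simp
  qed
  hence "S = (\<lambda>U. (\<lambda>v. B *\<^sub>v v) ` U) ` T" unfolding A(3) by (simp add: image_image[of "\<lambda>U. (\<lambda>v. B *\<^sub>v v) ` U"])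
  moreover have "invertible_mat B" using A(1) B unfolding invertible_mat_def inverts_mat_def by auto
  ultimately show ?thesis unfolding GL_equivalent_def using B(1) by blast
qed

lemma block_cols_carrier: "U \<in> block_cols N l (H :: 'a::field mat) \<Longrightarrow> H \<in> carrier_mat r n \<Longrightarrow> U \<subseteq> carrier_vec r"
  by (auto simp: block_cols_def Col_eq mat_block_def intro!: carrier_vecI)

text \<open>Forwards, the matrix transported by the isometry and \<open>L\<close> both belong to
  \<open>D\<close>, so they differ by a left factor. Backwards, \<open>A * H\<close> still belongs
  to \<open>C\<close> and has the column spaces of \<open>L\<close>.\<close>

lemma isometric_iff_GL_equivalent:
  assumes N: "N \<ge> 1" and "SR_code3 N r l C" "SR_code3 N r l D"
    and pc: "parity_check r (l * N) C (H :: 'a::{field,finite} mat)" and pd: "parity_check r (l * N) D L"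
  shows "SR_isometric N l C D \<longleftrightarrow> GL_equivalent r (block_cols N l H) (block_cols N l L)"
proof
  have H: "H \<in> carrier_mat r (l * N)" and L: "L \<in> carrier_mat r (l * N)" using pc pd unfolding parity_check_iff by auto
  assume "SR_isometric N l C D"
  then obtain L' where L': "parity_check r (l * N) D L'" "block_cols N l L' = block_cols N l H"
    using isometric_imp_parity_check[OF N pc] by metis
  obtain A where A: "A \<in> carrier_mat r r" "invertible_mat A" "L' = A * L" using parity_check_unique[OF pd L'(1)] by metis
  have "block_cols N l H = (\<lambda>U. (\<lambda>v. A *\<^sub>v v) ` U) ` block_cols N l L"
    using block_cols_mult_left[OF A(1) L N] A(3) L'(2) by simp
  hence "GL_equivalent r (block_cols N l L) (block_cols N l H)" unfolding GL_equivalent_def using A by blast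
  thus "GL_equivalent r (block_cols N l H) (block_cols N l L)"
    using GL_equivalent_sym block_cols_carrier[OF _ L] by blast
next
  have H: "H \<in> carrier_mat r (l * N)" using pc unfolding parity_check_iff by auto
  assume "GL_equivalent r (block_cols N l H) (block_cols N l L)"
  then obtain A where A: "A \<in> carrier_mat r r" "invertible_mat A"
    "block_cols N l L = (\<lambda>U. (\<lambda>v. A *\<^sub>v v) ` U) ` block_cols N l H"
    unfolding GL_equivalent_def by blast
  have "block_cols N l (A * H) = block_cols N l L" using block_cols_mult_left[OF A(1) H N] A(3) by simp
  moreover have p: "parity_check r (l * N) C (A * H)" by (rule parity_check_mult_left[OF pc A(1,2)])
  ultimately show "SR_isometric N l C D"
    using block_cols_eq_imp_isometric[OF N p pd] parity_check_spread_mat assms by metis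
qed

section \<open>Partial spreads and parity-check matrices\<close>

text \<open>A concrete quotient by the line spanned by \<open>w\<close>: coordinate j, where
  \<open>w\<close> is nonzero, is cleared by subtracting a multiple of \<open>w\<close> and then
  dropped.\<close>

lemma project_mat:
  assumes w: "w \<in> carrier_vec (Suc k)" "w \<noteq> (0\<^sub>v (Suc k) :: 'a::field vec)"
  obtains T where "T \<in> carrier_mat k (Suc k)" "(\<lambda>x. T *\<^sub>v x) ` carrier_vec (Suc k) = carrier_vec k"
    "\<And>x. x \<in> carrier_vec (Suc k) \<Longrightarrow> T *\<^sub>v x = 0\<^sub>v k \<Longrightarrow> \<exists>a. x = a \<cdot>\<^sub>v w"
proof -
  obtain j where j: "j < Suc k" "w $ j \<noteq> 0" using w by (metis eq_vecI carrier_vecD index_zero_vec)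
  \<comment> \<open>The indices other than j in increasing order.\<close>
  define \<rho> where "\<rho> i = (if i < j then i else Suc i)" for i
  define \<phi> where "\<phi> x = vec k (\<lambda>i. x $ \<rho> i - (w $ \<rho> i / w $ j) * x $ j)" for x :: "'a vec"
  have \<rho>: "\<rho> i < Suc k" if "i < k" for i using that by (auto simp: \<rho>_def)
  have lin: "linear_map class_ring (module_vec TYPE('a) (Suc k)) (module_vec TYPE('a) k) \<phi>"
    unfolding linear_map_iff using \<rho> j(1)
    by (auto simp: \<phi>_def field_simps j(2) intro!: eq_vecI)
  obtain T where T: "T \<in> carrier_mat k (Suc k)" "\<And>x. x \<in> carrier_vec (Suc k) \<Longrightarrow> T *\<^sub>v x = \<phi> x"
    by (rule linear_map_mat[OF lin]) blast
  have "y \<in> (\<lambda>x. T *\<^sub>v x) ` carrier_vec (Suc k)" if y: "y \<in> carrier_vec k" for y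
  proof
    \<comment> \<open>Coordinate j of the preimage is 0, so nothing is subtracted from the
      others.\<close>
    define x where "x = vec (Suc k) (\<lambda>m. if m < j then y $ m else if m = j then 0 else y $ (m - 1))"
    show x: "x \<in> carrier_vec (Suc k)" by (simp add: x_def)
    have "x $ \<rho> i = y $ i" if "i < k" for i using that \<rho>[OF that] by (auto simp: x_def \<rho>_def)
    moreover have "x $ j = 0" using j(1) by (simp add: x_def)
    ultimately have "\<phi> x = y" using y by (auto simp: \<phi>_def intro!: eq_vecI)
    thus "y = T *\<^sub>v x" using T(2)[OF x] by simp
  qed
  hence "(\<lambda>x. T *\<^sub>v x) ` carrier_vec (Suc k) = carrier_vec k" using T(1) by auto
  moreover have "\<exists>a. x = a \<cdot>\<^sub>v w" if x: "x \<in> carrier_vec (Suc k)" and 0: "T *\<^sub>v x = 0\<^sub>v k" for x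
  proof (intro exI eq_vecI)
    fix m assume "m < dim_vec ((x $ j / w $ j) \<cdot>\<^sub>v w)"
    hence m: "m < Suc k" using w(1) by simp
    show "x $ m = ((x $ j / w $ j) \<cdot>\<^sub>v w) $ m"
    proof (cases "m = j")
      case False
      define i where "i = (if m < j then m else m - 1)"
      have i: "i < k" "\<rho> i = m" using m j(1) False by (auto simp: i_def \<rho>_def)
      have "\<phi> x $ i = 0" using 0 T(2)[OF x] i(1) by simp
      hence "x $ m = (w $ m / w $ j) * x $ j" using i by (simp add: \<phi>_def)
      thus ?thesis using m w(1) by simp
    qed (use m w(1) j in auto)
  qed (use x w in auto)
  ultimately show ?thesis using that T(1) by blast
qed

text \<open>Take the least height k of a surjective matrix with kernel inside \<open>C\<close>. If
  some \<open>v\<close> in \<open>C\<close> had a nonzero syndrome, dividing out the line of that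
  syndrome would lower k and keep the kernel inside \<open>C\<close>. Counting then gives k =
  r.\<close>

lemma parity_check_exists:
  assumes lin: "linear_code n (C :: 'a::{field,finite} vec set)" and dim: "r + subspace_dim n C = n"
  obtains H where "parity_check r n C H"
proof -
  define P where "P k \<longleftrightarrow> (\<exists>H\<in>carrier_mat k n. (\<lambda>x. H *\<^sub>v x) ` carrier_vec n = carrier_vec k \<and>
      {c \<in> carrier_vec n. H *\<^sub>v c = 0\<^sub>v k} \<subseteq> C)" for k
  have "P n" unfolding P_def
  proof (intro bexI[of _ "1\<^sub>m n"] conjI)
    show "(\<lambda>x. 1\<^sub>m n *\<^sub>v x) ` carrier_vec n = (carrier_vec n :: 'a vec set)" by (auto simp: image_iff)
    show "{c \<in> carrier_vec n. 1\<^sub>m n *\<^sub>v c = 0\<^sub>v n} \<subseteq> C" using linear_codeD(2)[OF lin] by auto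
  qed auto
  define k where "k = (LEAST k. P k)"
  have "P k" unfolding k_def using \<open>P n\<close> by (rule LeastI)
  then obtain H where H: "H \<in> carrier_mat k n" "(\<lambda>x. H *\<^sub>v x) ` carrier_vec n = carrier_vec k"
    and ker: "{c \<in> carrier_vec n. H *\<^sub>v c = 0\<^sub>v k} \<subseteq> C" unfolding P_def by blast
  have "C \<subseteq> {c \<in> carrier_vec n. H *\<^sub>v c = 0\<^sub>v k}"
  proof (rule ccontr)
    assume "\<not> ?thesis"
    then obtain v where v: "v \<in> C" "H *\<^sub>v v \<noteq> 0\<^sub>v k" using linear_codeD(1)[OF lin] by blast
    hence vc: "v \<in> carrier_vec n" using linear_codeD(1)[OF lin] by blast
    have Hv: "H *\<^sub>v v \<in> carrier_vec k" using H(1) vc by auto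
    have "k \<noteq> 0"
    proof
      assume "k = 0"
      hence "H *\<^sub>v v = 0\<^sub>v k" using Hv by (intro eq_vecI) (simp_all del: dim_mult_mat_vec)
      thus False using v(2) by simp
    qed
    then obtain k' where k': "k = Suc k'" by (cases k) auto
    obtain T where T: "T \<in> carrier_mat k' k" "(\<lambda>x. T *\<^sub>v x) ` carrier_vec k = carrier_vec k'"
      and Tker: "\<And>x. x \<in> carrier_vec k \<Longrightarrow> T *\<^sub>v x = 0\<^sub>v k' \<Longrightarrow> \<exists>a. x = a \<cdot>\<^sub>v (H *\<^sub>v v)"
      using project_mat[of "H *\<^sub>v v" k'] Hv v(2) unfolding k' by metis
    have "P k'" unfolding P_def
    proof (intro bexI[of _ "T * H"] conjI subsetI)
      show "(\<lambda>x. (T * H) *\<^sub>v x) ` carrier_vec n = carrier_vec k'"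
        using image_compose_mult[OF T(1) H(1), of "carrier_vec n"] H(2) T(2) by simp
      fix c assume "c \<in> {c \<in> carrier_vec n. (T * H) *\<^sub>v c = 0\<^sub>v k'}"
      hence c: "c \<in> carrier_vec n" "T *\<^sub>v (H *\<^sub>v c) = 0\<^sub>v k'" using T(1) H(1) by auto
      \<comment> \<open>The syndrome of \<open>c\<close> is a multiple of that of \<open>v\<close>,
        so \<open>c\<close> differs from a multiple of \<open>v\<close> by an element of the old
        kernel.\<close>
      then obtain a where a: "H *\<^sub>v c = a \<cdot>\<^sub>v (H *\<^sub>v v)" using Tker[of "H *\<^sub>v c"] H(1) by auto
      have av: "a \<cdot>\<^sub>v v \<in> carrier_vec n" "a \<cdot>\<^sub>v v \<in> C" using vc v(1) linear_codeD(4)[OF lin] by auto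
      have "H *\<^sub>v (c - a \<cdot>\<^sub>v v) = 0\<^sub>v k"
        unfolding mult_mat_vec_diff[OF H(1) c(1) av(1)] mult_mat_vec[OF H(1) vc] a using Hv by auto
      hence "c - a \<cdot>\<^sub>v v \<in> C" using ker c(1) av(1) by auto
      hence "c - a \<cdot>\<^sub>v v + a \<cdot>\<^sub>v v \<in> C" using linear_codeD(3)[OF lin] av by blast
      moreover have "c - a \<cdot>\<^sub>v v + a \<cdot>\<^sub>v v = c" using c(1) av(1) by (intro eq_vecI) auto
      ultimately show "c \<in> C" by simp
    qed (use T(1) H(1) in auto)
    hence "k \<le> k'" unfolding k_def by (rule Least_le)
    thus False using k' by simp
  qed
  with ker have C: "C = {c \<in> carrier_vec n. H *\<^sub>v c = 0\<^sub>v k}" by blast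
  have "CARD('a) ^ n = CARD('a) ^ k * card C"
    using card_image_kernel[OF H(1) linear_code_carrier] by (simp add: H(2) card_carrier_vec C)
  hence "CARD('a) ^ n = CARD('a) ^ (k + subspace_dim n C)"
    by (simp add: card_linear_code[OF lin] power_add)
  hence "n = k + subspace_dim n C" using field_card_gt_1[where 'a='a] by simp
  hence "k = r" using dim by simp
  thus ?thesis using that H C unfolding parity_check_iff by blast
qed

lemma subspace_basis_mat:
  assumes "linear_code r (U :: 'a::{field,finite} vec set)" "subspace_dim r U = N"
  obtains B where "B \<in> carrier_mat r N" "(\<lambda>x. B *\<^sub>v x) ` carrier_vec N = U"
proof -
  interpret vec_space "TYPE('a)" r .
  have sub: "VectorSpace.subspace class_ring U V" using assms(1) unfolding linear_code_def .
  hence subm: "submodule class_ring U V" unfolding VectorSpace.subspace_def by blast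
  interpret W: vectorspace class_ring "vs U" using sub by (rule subspace_is_vs)
  have "W.fin_dim" by (rule W.finite_carrier_fin_dim) (simp add: linear_code_finite[OF assms(1)])
  then obtain B where B: "finite B" "W.basis B" using W.finite_basis_exists by blast
  have BU: "B \<subseteq> U" "W.span B = U" using B(2) unfolding W.basis_def by auto
  have cB: "card B = N" using W.dim_basis[OF B] assms(2) unfolding subspace_dim_def by simp
  have sp: "span B = U" using span_li_not_depend(1)[OF BU(1) subm] BU(2) by simp
  have Bc: "B \<subseteq> carrier_vec r" using BU(1) linear_codeD(1)[OF assms(1)] by blast
  obtain bs where bs: "set bs = B" "distinct bs" using finite_distinct_list[OF B(1)] by blast
  have len: "length bs = N" using bs cB by (metis distinct_card)
  define M where "M = mat_of_cols r bs"
  have M: "M \<in> carrier_mat r N" unfolding M_def using len by (simp add: mat_of_cols_def)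
  have "col_space M = U" unfolding col_space_def M_def using bs Bc sp by (simp add: cols_mat_of_cols)
  moreover have "col_space M = (\<lambda>x. M *\<^sub>v x) ` carrier_vec N"
    using Col_eq[of M] M unfolding Col_def by auto
  ultimately show ?thesis using that M by blast
qed

lemma partial_spread_iff:
  "partial_spread N r (S :: 'a::{field,finite} vec set set) \<longleftrightarrow> 1 \<le> N \<and> N \<le> r \<and>
     (\<forall>U\<in>S. linear_code r U \<and> card U = CARD('a) ^ N) \<and>
     (\<forall>U \<in> S. \<forall>W \<in> S. U \<noteq> W \<longrightarrow> U \<inter> W = {0\<^sub>v r})"
proof -
  have "linear_code r U \<and> subspace_dim r U = N \<longleftrightarrow> linear_code r U \<and> card U = CARD('a) ^ N" for U :: "'a vec set"
    using subspace_dim_eq_iff[of r U N] by blast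
  thus ?thesis unfolding partial_spread_def linear_code_def[symmetric] by simp
qed

lemma partial_spread_finite:
  assumes "partial_spread N r (S :: 'a::{field,finite} vec set set)" shows "finite S"
proof (rule finite_subset)
  show "S \<subseteq> Pow (carrier_vec r)" using assms unfolding partial_spread_iff linear_code_iff by auto
qed (simp add: finite_carrier_vec)

text \<open>Basis matrices of the members stand side by side in some enumeration. Full column rank
  is recovered by counting: a block space and its image, a member, both have q^N elements.\<close>

lemma partial_spread_matrix:
  assumes S: "partial_spread N r (S :: 'a::{field,finite} vec set set)"
  obtains H where "H \<in> carrier_mat r (card S * N)" "spread_mat N r (card S) H"
    "block_cols N (card S) H = S"
proof -
  let ?l = "card S"
  have N: "N \<ge> 1" using S unfolding partial_spread_iff by simp
  obtain U where U: "bij_betw U {..<?l} S"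
    using ex_bij_betw_nat_finite[OF partial_spread_finite[OF S]] by (metis atLeast0LessThan)
  have US: "U i \<in> S" if "i < ?l" for i using U that by (auto simp: bij_betw_def)
  have "\<exists>B. i < ?l \<longrightarrow> B \<in> carrier_mat r N \<and> (\<lambda>x. B *\<^sub>v x) ` carrier_vec N = U i" for i
    using subspace_basis_mat[of r "U i" N] US[of i] S subspace_dim_eq_iff
    unfolding partial_spread_iff by metis
  then obtain B where B: "\<And>i. i < ?l \<Longrightarrow> B i \<in> carrier_mat r N"
    "\<And>i. i < ?l \<Longrightarrow> (\<lambda>x. B i *\<^sub>v x) ` carrier_vec N = U i" by metis
  define H where "H = mat r (?l * N) (\<lambda>(a, k). B (k div N) $$ (a, k mod N))"
  have H: "H \<in> carrier_mat r (?l * N)" by (simp add: H_def)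
  have Col: "Col (mat_block N i H) = U i" if i: "i < ?l" for i
  proof -
    have "mat_block N i H = B i"
      using B(1)[OF i] block_index_less[OF i] by (auto simp: mat_block_def H_def intro!: eq_matI)
    thus ?thesis using B[OF i] by (auto simp: Col_eq)
  qed
  hence im: "(\<lambda>c. H *\<^sub>v c) ` block_space N ?l i = U i" if "i < ?l" for i
    using Col_mat_block[OF H that N] that by simp
  have "block_cols N ?l H = U ` {..<?l}" using block_cols_eq[OF H N] im by simp
  also have "\<dots> = S" using U by (simp add: bij_betw_def)
  finally have bc: "block_cols N ?l H = S" .
  have "spread_mat N r ?l H"
    unfolding spread_mat_def
  proof (intro conjI allI impI ballI)
    fix i c assume i: "i < ?l" and c: "c \<in> block_space N ?l i" "H *\<^sub>v c = 0\<^sub>v r"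
    have "card ((\<lambda>c. H *\<^sub>v c) ` block_space N ?l i) = card (block_space N ?l i :: 'a vec set)"
      unfolding im[OF i] using card_block_space[OF i N, where 'a='a] US[OF i] S unfolding partial_spread_iff by simp
    hence inj: "inj_on (\<lambda>c. H *\<^sub>v c) (block_space N ?l i)"
      using eq_card_imp_inj_on linear_code_finite[OF linear_code_block_space] by blast
    have "H *\<^sub>v c = H *\<^sub>v 0\<^sub>v (?l * N)" using c(2) mult_mat_zero_vec[OF H] by simp
    thus "c = 0\<^sub>v (?l * N)" using inj c(1) linear_codeD(2)[OF linear_code_block_space] by (metis inj_onD)
  next
    fix i j assume ij: "i < ?l" "j < ?l" "i \<noteq> j"
    have "U i \<noteq> U j" using U ij by (auto simp: bij_betw_def dest: inj_onD)
    thus "(\<lambda>c. H *\<^sub>v c) ` block_space N ?l i \<inter> (\<lambda>c. H *\<^sub>v c) ` block_space N ?l j = {0\<^sub>v r}"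
      using im ij US S unfolding partial_spread_iff by simp
  qed
  thus ?thesis using that H bc by blast
qed

lemma spread_mat_partial_spread:
  assumes H: "(H :: 'a::{field,finite} mat) \<in> carrier_mat r (l * N)" and s: "spread_mat N r l H"
    and N: "N \<ge> 1" and l: "l \<ge> 1"
  shows "partial_spread N r (block_cols N l H)" "card (block_cols N l H) = l"
proof -
  let ?HV = "\<lambda>i. (\<lambda>c. H *\<^sub>v c) ` block_space N l i"
  have lin: "linear_code r (?HV i)" for i by (rule linear_code_image[OF H linear_code_block_space])
  have cd: "card (?HV i) = CARD('a) ^ N" if "i < l" for i by (rule card_block_image[OF H s that N])
  have "card (?HV 0) \<le> card (carrier_vec r :: 'a vec set)"
    by (rule card_mono[OF finite_carrier_vec linear_codeD(1)[OF lin]])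
  hence "CARD('a) ^ N \<le> CARD('a) ^ r" using cd[of 0] l by (simp add: card_carrier_vec)
  hence "N \<le> r" using field_card_gt_1[where 'a='a] by simp
  moreover have "U \<inter> W = {0\<^sub>v r}"
    if U: "U \<in> block_cols N l H" and W: "W \<in> block_cols N l H" and ne: "U \<noteq> W" for U W
  proof -
    obtain i where i: "i < l" "U = ?HV i" using U unfolding block_cols_eq[OF H N] by blast
    obtain j where j: "j < l" "W = ?HV j" using W unfolding block_cols_eq[OF H N] by blast
    show ?thesis unfolding i j by (rule spread_mat_disjoint[OF s i(1) j(1)]) (use ne i j in auto)
  qed
  moreover have "linear_code r U \<and> card U = CARD('a) ^ N" if U: "U \<in> block_cols N l H" for U
    using U lin cd unfolding block_cols_eq[OF H N] by auto
  ultimately show "partial_spread N r (block_cols N l H)"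
    unfolding partial_spread_iff using N by blast
  show "card (block_cols N l H) = l"
    unfolding block_cols_eq[OF H N] using card_image[OF spread_mat_inj_blocks[OF H s N]] by simp
qed

section \<open>Counting bounds for subspaces that meet trivially\<close>

text \<open>The members without zero are disjoint sets of q^N - 1 vectors inside \<open>W\<close>,
  and a proper subspace has at most q^(r-1) elements. The zero vector, left uncovered, makes the
  bound strict.\<close>

lemma partial_spread_in_proper_subspace:
  assumes S: "partial_spread N r (S :: 'a::{field,finite} vec set set)"
    and W: "linear_code r W" "W \<noteq> carrier_vec r" and sub: "\<And>U. U \<in> S \<Longrightarrow> U \<subseteq> W"
  shows "card S * (CARD('a) ^ N - 1) < CARD('a) ^ (r - 1)" and "r \<ge> 1"
proof -
  have finW: "finite W" by (rule linear_code_finite[OF W(1)])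
  have "W \<subset> carrier_vec r" using linear_codeD(1)[OF W(1)] W(2) by blast
  hence "card W < CARD('a) ^ r"
    using psubset_card_mono[OF finite_carrier_vec, of W r] by (simp add: card_carrier_vec)
  hence "CARD('a) ^ subspace_dim r W < CARD('a) ^ r" by (simp add: card_linear_code[OF W(1)])
  hence d: "subspace_dim r W < r" using field_card_gt_1[where 'a='a] by simp
  thus "r \<ge> 1" by simp
  have cW: "card W \<le> CARD('a) ^ (r - 1)"
    unfolding card_linear_code[OF W(1)] using d field_card_gt_1[where 'a='a] by (intro power_increasing) auto
  have z: "0\<^sub>v r \<in> U" "card U = CARD('a) ^ N" "finite U" if "U \<in> S" for U
    using that S linear_codeD(2)[of r U] linear_code_finite[of r U] unfolding partial_spread_iff by auto
  have disj: "(U - {0\<^sub>v r}) \<inter> (U' - {0\<^sub>v r}) = {}" if "U \<in> S" "U' \<in> S" "U \<noteq> U'" for U U'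
    using S that unfolding partial_spread_iff by blast
  have "card (\<Union>U\<in>S. U - {0\<^sub>v r}) = (\<Sum>U\<in>S. card (U - {0\<^sub>v r}))"
    using z(3) partial_spread_finite[OF S] disj by (intro card_UN_disjoint) blast+
  also have "\<dots> = card S * (CARD('a) ^ N - 1)" using z by simp
  finally have "card S * (CARD('a) ^ N - 1) = card (\<Union>U\<in>S. U - {0\<^sub>v r})" ..
  also have "\<dots> \<le> card (W - {0\<^sub>v r})" using sub finW by (intro card_mono) auto
  also have "\<dots> < card W" using finW linear_codeD(2)[OF W(1)] by (rule card_Diff1_less)
  finally show "card S * (CARD('a) ^ N - 1) < CARD('a) ^ (r - 1)" using cW by simp
qed

text \<open>If \<open>u - w = u' - w'\<close>, then \<open>u - u' = w - w'\<close> lies in both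
  subspaces and is zero, so the pairs have distinct differences.\<close>

lemma card_add_disjoint_subspaces:
  assumes "linear_code r (U :: 'a::{field,finite} vec set)" "linear_code r W" "U \<inter> W = {0\<^sub>v r}"
  shows "card U * card W \<le> CARD('a) ^ r"
proof -
  have c: "u \<in> carrier_vec r" if "u \<in> U \<union> W" for u using that assms(1,2) linear_codeD(1) by blast
  have "inj_on (\<lambda>(u, w). u - w) (U \<times> W)"
  proof (rule inj_onI, clarify)
    fix u w u' w' assume uw: "u \<in> U" "w \<in> W" "u' \<in> U" "w' \<in> W" and eq: "u - w = u' - w'"
    have k: "u \<in> carrier_vec r" "w \<in> carrier_vec r" "u' \<in> carrier_vec r" "w' \<in> carrier_vec r" using c uw by auto
    have "u - u' = w - w'"
    proof (intro eq_vecI)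
      fix i assume i: "i < dim_vec (w - w')"
      have "(u - w) $ i = (u' - w') $ i" using eq by simp
      thus "(u - u') $ i = (w - w') $ i" using i k by (simp add: algebra_simps)
    qed (use k in auto)
    moreover have "u - u' \<in> U" "w - w' \<in> W" using uw linear_codeD(5) assms(1,2) by blast+
    ultimately have "u - u' = 0\<^sub>v r" "w - w' = 0\<^sub>v r" using assms(3) by (metis IntI singletonD)+
    thus "u = u' \<and> w = w'" using vec_diff_eq_0_iff k by blast
  qed
  hence "card (U \<times> W) = card ((\<lambda>(u, w). u - w) ` (U \<times> W))" by (simp add: card_image)
  also have "\<dots> \<le> card (carrier_vec r :: 'a vec set)"
    using c by (intro card_mono finite_carrier_vec) auto
  finally show ?thesis by (simp add: card_cartesian_product card_carrier_vec)
qed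

text \<open>With one block, \<open>H\<close> is a bijection onto the whole space, so r = N; with
  more, two column spaces that meet trivially need 2 * N dimensions.\<close>

lemma spread_mat_redundancy_cases:
  assumes H: "(H :: 'a::{field,finite} mat) \<in> carrier_mat r (l * N)" and s: "spread_mat N r l H"
    and surj: "(\<lambda>x. H *\<^sub>v x) ` carrier_vec (l * N) = carrier_vec r"
    and N: "N \<ge> 1" and l: "l \<ge> 1"
  shows "r = N \<or> 2 * N \<le> r"
proof (cases "l = 1")
  case True
  have "block_space N l 0 = (carrier_vec (l * N) :: 'a vec set)"
    unfolding True by (auto simp: block_space_iff)
  hence "CARD('a) ^ r = CARD('a) ^ N" using card_block_image[OF H s _ N, of 0] surj l by (simp add: card_carrier_vec)
  thus ?thesis using field_card_gt_1[where 'a='a] by simp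
next
  case False
  hence l2: "0 < l" "1 < l" using l by auto
  have "CARD('a) ^ N * CARD('a) ^ N \<le> CARD('a) ^ r"
    using card_add_disjoint_subspaces[OF linear_code_image[OF H linear_code_block_space]
      linear_code_image[OF H linear_code_block_space] spread_mat_disjoint[OF s l2]]
      card_block_image[OF H s l2(1) N] card_block_image[OF H s l2(2) N] by simp
  hence "CARD('a) ^ (2 * N) \<le> CARD('a) ^ r" by (simp add: power_add mult_2)
  thus ?thesis using field_card_gt_1[where 'a='a] by simp
qed

section \<open>Large partial spreads\<close>

text \<open>Multiplication by \<open>x\<close> permutes the nonzero elements, so it multiplies their
  product by this power and yet leaves it unchanged.\<close>

lemma finite_field_power_card_minus_1:
  assumes "x \<noteq> (0 :: 'a::{field,finite})"
  shows "x ^ (CARD('a) - 1) = 1"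
proof -
  have "bij_betw (\<lambda>y. x * y) (UNIV - {0}) (UNIV - {0})"
    by (rule bij_betw_byWitness[where f' = "\<lambda>y. y / x"]) (use assms in auto)
  hence "(\<Prod>y\<in>UNIV - {0}. x * y) = (\<Prod>y\<in>UNIV - {0}. y)" by (rule prod.reindex_bij_betw)
  hence "x ^ card (UNIV - {0 :: 'a}) * (\<Prod>y\<in>UNIV - {0}. y) = (\<Prod>y\<in>UNIV - {0}. y)"
    by (simp add: prod.distrib)
  moreover have "(\<Prod>y\<in>UNIV - {0 :: 'a}. y) \<noteq> 0" by (simp add: prod_zero_iff)
  ultimately show ?thesis by (simp add: card_Diff_singleton)
qed

lemma finite_field_power_card:
  "(x :: 'a::{field,finite}) ^ CARD('a) = x"
proof (cases "x = 0")
  case False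
  have "x ^ CARD('a) = x * x ^ (CARD('a) - 1)"
    using field_card_gt_1[where 'a='a] by (simp flip: power_Suc)
  thus ?thesis using finite_field_power_card_minus_1[OF False] by simp
qed (use field_card_gt_1[where 'a='a] in auto)

lemma finite_field_power_card_power: "(x :: 'a::{field,finite}) ^ (CARD('a) ^ m) = x"
  by (induction m) (simp_all add: power_mult finite_field_power_card)

lemma finite_field_prime_CHAR: "Factorial_Ring.prime CHAR('a::{field,finite})"
  by (intro prime_CHAR_semidom finite_imp_CHAR_pos) auto

text \<open>By Euler's theorem for the exponent \<open>CARD('a) - 1\<close>. That \<open>CARD('a)\<close> is itself a power of the
  characteristic follows only later, by counting the fixed field in the algebraic closure as a
  vector space over \<open>'a\<close>.\<close>

lemma finite_field_frobenius_identity: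
  obtains e where "e \<ge> 1" "\<And>x :: 'a::{field,finite}. x ^ (CHAR('a) ^ e) = x"
proof
  let ?m = "CARD('a) - 1" and ?p = "CHAR('a)"
  have m: "?m \<ge> 1" using field_card_gt_1[where 'a='a] by simp
  \<comment> \<open>The exponent e is the totient of q - 1.\<close>
  show "totient ?m \<ge> 1" using m by (simp add: Suc_le_eq)
  \<comment> \<open>Consecutive numbers are coprime, and the characteristic divides q; so it is
    coprime to q - 1.\<close>
  have "coprime CARD('a) ?m" using coprime_Suc_left_nat[of ?m] m by simp
  moreover have "?p dvd CARD('a)" by (rule CHAR_dvd_CARD)
  ultimately have "coprime ?p ?m" by (meson coprime_divisors dvd_refl)
  hence "[?p ^ totient ?m = 1] (mod ?m)" by (rule euler_theorem)
  hence d: "?m dvd ?p ^ totient ?m - 1"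
    using cong_to_1_nat by blast
  fix x :: 'a
  show "x ^ (?p ^ totient ?m) = x"
  proof (cases "x = 0")
    case False
    have "?p ^ totient ?m > 0" using finite_field_prime_CHAR[where 'a='a] by (simp add: prime_gt_0_nat)
    hence "x ^ (?p ^ totient ?m) = x * x ^ (?p ^ totient ?m - 1)" by (simp flip: power_Suc)
    also obtain k where "?p ^ totient ?m - 1 = ?m * k" using d by blast
    hence "x ^ (?p ^ totient ?m - 1) = (x ^ ?m) ^ k" by (simp only: power_mult)
    hence "x ^ (?p ^ totient ?m - 1) = 1" by (simp only: finite_field_power_card_minus_1[OF False] power_one)
    finally show ?thesis by simp
  qed (use finite_field_prime_CHAR[where 'a='a] in \<open>simp add: prime_gt_0_nat\<close>)
qed

section \<open>Extension fields inside the algebraic closure\<close>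

text \<open>The polynomial X^P - X splits over the algebraic closure and has derivative -1, hence P
  distinct roots.\<close>

lemma card_frobenius_fixed:
  fixes e :: nat
  assumes e: "e \<ge> 1"
  defines "P \<equiv> CHAR('a::{field,finite}) ^ e"
  shows "card {x :: 'a alg_closure. x ^ P = x} = P" and "finite {x :: 'a alg_closure. x ^ P = x}"
proof -
  let ?K = "{x :: 'a alg_closure. x ^ P = x}"
  have prime: "Factorial_Ring.prime CHAR('a)" by (rule finite_field_prime_CHAR)
  have P2: "P \<ge> 2" unfolding P_def using prime_ge_2_nat[OF prime] e
    by (metis le_trans power_increasing power_one_right one_le_numeral)
  define f :: "'a alg_closure poly" where "f = Polynomial.monom 1 P - Polynomial.monom 1 1"
  have cf: "poly.coeff f P = 1" using P2 by (simp add: f_def)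
  have deg: "Polynomial.degree f = P"
  proof (rule antisym)
    show "Polynomial.degree f \<le> P" unfolding f_def using P2 by (intro degree_diff_le) (auto simp: degree_monom_eq)
    show "P \<le> Polynomial.degree f" using cf by (intro le_degree) simp
  qed
  have f0: "f \<noteq> 0" using cf by auto
  have root: "poly f x = 0 \<longleftrightarrow> x \<in> ?K" for x by (simp add: f_def poly_monom)
  \<comment> \<open>Since \<open>e \<ge> 1\<close>, the characteristic divides \<open>P\<close>, and
    the leading term contributes nothing to the derivative.\<close>
  have "of_nat P = (0 :: 'a alg_closure)"
    unfolding of_nat_eq_0_iff_char_dvd using e by (simp add: P_def)
  hence pd: "pderiv f = - 1" by (simp add: f_def pderiv_diff pderiv_monom)
  obtain A where A: "size A = Polynomial.degree f" "f = smult (Polynomial.lead_coeff f) (\<Prod>x\<in>#A. [:-x, 1:])"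
    using alg_closed_imp_factorization[OF f0] by blast
  have "count A x \<le> 1" for x
  proof (rule ccontr)
    assume "\<not> count A x \<le> 1"
    \<comment> \<open>A double root splits off the square of a linear factor, so the derivative
      would vanish there too.\<close>
    hence "{#x, x#} \<subseteq># A" by (simp add: insert_subset_eq_iff subseteq_mset_def)
    then obtain B where "A = {#x, x#} + B" by (metis subset_mset.le_iff_add)
    hence "f = [:-x, 1:] * ([:-x, 1:] * smult (Polynomial.lead_coeff f) (\<Prod>x\<in>#B. [:-x, 1:]))"
      using A(2) by (simp add: mult.assoc)
    then obtain g where "f = [:-x, 1:] * ([:-x, 1:] * g)" by blast
    hence "poly (pderiv f) x = 0" by (simp add: pderiv_mult pderiv_pCons del: mult_pCons_left)
    thus False using pd by simp
  qed
  hence "count A x = 1" if "x \<in># A" for x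
    using that by (simp add: le_antisym Suc_le_eq)
  hence "size A = card (set_mset A)" by (simp add: size_multiset_overloaded_eq)
  moreover have "set_mset A = ?K"
  proof -
    have "poly f x = 0 \<longleftrightarrow> x \<in># A" for x
      by (subst A(2)) (use f0 in \<open>auto simp: poly_prod_mset prod_mset_zero_iff\<close>)
    thus ?thesis using root by blast
  qed
  ultimately show "card ?K = P" "finite ?K" using A(1) deg by (simp, metis finite_set_mset)
qed

text \<open>The coordinate map of a family \<open>b\<close> in the algebraic closure over
  \<open>'a\<close>. Linear independence of \<open>b\<close> is expressed as injectivity of this
  map.\<close>

definition ac_comb :: "(nat \<Rightarrow> 'a::field alg_closure) \<Rightarrow> nat \<Rightarrow> 'a vec \<Rightarrow> 'a alg_closure" where
  "ac_comb b m v = (\<Sum>i<m. to_ac (v $ i) * b i)"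

lemma ac_comb_add: "u \<in> carrier_vec m \<Longrightarrow> v \<in> carrier_vec m \<Longrightarrow> ac_comb b m (u + v) = ac_comb b m u + ac_comb b m v"
  by (simp add: ac_comb_def sum.distrib algebra_simps)

lemma ac_comb_smult: "u \<in> carrier_vec m \<Longrightarrow> ac_comb b m (a \<cdot>\<^sub>v u) = to_ac a * ac_comb b m u"
  by (simp add: ac_comb_def sum_distrib_left algebra_simps)

text \<open>An independent family of maximal length spans \<open>K\<close>. Lengths are bounded
  because m < q^m and the q^m combinations are distinct elements of \<open>K\<close>.\<close>

lemma ac_basis_exists:
  assumes fin: "finite (K :: 'a::{field,finite} alg_closure set)" and K0: "0 \<in> K"
    and add: "\<And>x y. x \<in> K \<Longrightarrow> y \<in> K \<Longrightarrow> x + y \<in> K" and sm: "\<And>a x. x \<in> K \<Longrightarrow> to_ac a * x \<in> K"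
  obtains b m where "bij_betw (ac_comb b m) (carrier_vec m) K"
proof -
  have inK: "ac_comb b m v \<in> K" if "\<And>i. i < m \<Longrightarrow> b i \<in> K" for b m v
  proof -
    have "(\<Sum>i\<in>T. to_ac (v $ i) * b i) \<in> K" if "finite T" "T \<subseteq> {..<m}" for T
      using that by (induction T) (auto simp: K0 add sm \<open>\<And>i. i < m \<Longrightarrow> b i \<in> K\<close>)
    thus ?thesis by (simp add: ac_comb_def)
  qed
  define Q where "Q m \<longleftrightarrow> (\<exists>b. (\<forall>i<m. b i \<in> K) \<and> inj_on (ac_comb b m) (carrier_vec m))" for m
  have "m \<le> card K" if Q: "Q m" for m
  proof -
    obtain b where b: "\<And>i. i < m \<Longrightarrow> b i \<in> K" "inj_on (ac_comb b m) (carrier_vec m)"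
      using Q unfolding Q_def by blast
    have "CARD('a) ^ m \<le> card K"
      using card_inj_on_le[OF b(2) _ fin] inK[of m b] b(1) by (simp add: card_carrier_vec image_subset_iff)
    moreover have "m < CARD('a) ^ m" using field_card_gt_1[where 'a='a] by (intro power_gt_expt) auto
    ultimately show ?thesis by simp
  qed
  moreover have "Q 0" unfolding Q_def by (auto simp: inj_on_def intro!: eq_vecI)
  ultimately have "Q (Greatest Q)" "\<And>k. Q k \<Longrightarrow> k \<le> Greatest Q"
    using GreatestI_nat[of Q 0 "card K"] Greatest_le_nat[of Q _ "card K"] by blast+
  then obtain m where m: "Q m" "\<And>k. Q k \<Longrightarrow> k \<le> m" by blast
  obtain b where b: "\<And>i. i < m \<Longrightarrow> b i \<in> K" "inj_on (ac_comb b m) (carrier_vec m)"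
    using m(1) unfolding Q_def by blast
  have "K \<subseteq> ac_comb b m ` carrier_vec m"
  proof (rule ccontr)
    assume "\<not> ?thesis"
    then obtain y where y: "y \<in> K" "y \<notin> ac_comb b m ` carrier_vec m" by blast
    define b' where "b' = b(m := y)"
    have dec: "ac_comb b' (Suc m) v = ac_comb b m (vec m (\<lambda>i. v $ i)) + to_ac (v $ m) * y" for v
      by (simp add: ac_comb_def b'_def)
    have "inj_on (ac_comb b' (Suc m)) (carrier_vec (Suc m))"
    proof
      fix u v :: "'a vec" assume uv: "u \<in> carrier_vec (Suc m)" "v \<in> carrier_vec (Suc m)"
        "ac_comb b' (Suc m) u = ac_comb b' (Suc m) v"
      let ?u = "vec m (\<lambda>i. u $ i)" and ?v = "vec m (\<lambda>i. v $ i)"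
      have eq: "to_ac (u $ m - v $ m) * y = ac_comb b m ?v - ac_comb b m ?u"
        using uv(3) by (simp add: dec algebra_simps)
      have last: "u $ m = v $ m"
      proof (rule ccontr)
        assume ne: "u $ m \<noteq> v $ m"
        \<comment> \<open>Dividing by the difference of the last coefficients expresses
          \<open>y\<close> through \<open>b\<close>, against the choice of \<open>y\<close>.\<close>
        let ?c = "1 / (u $ m - v $ m)"
        have "?c * (u $ m - v $ m) = 1" using ne by simp
        hence "to_ac ?c * to_ac (u $ m - v $ m) = 1" by (metis to_ac_1 to_ac_mult)
        hence "y = to_ac ?c * (to_ac (u $ m - v $ m) * y)" by (simp only: mult.assoc[symmetric] mult_1_left)
        also have "\<dots> = ac_comb b m (?c \<cdot>\<^sub>v (?v + (-1) \<cdot>\<^sub>v ?u))"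
          unfolding eq by (subst ac_comb_smult; (subst ac_comb_add)?; (subst ac_comb_smult)?; simp)
        finally show False using y(2) by simp
      qed
      hence "ac_comb b m ?u = ac_comb b m ?v" using eq by simp
      hence "?u = ?v" using b(2) by (auto dest: inj_onD)
      hence "u $ i = v $ i" if "i < m" for i using that by (metis index_vec)
      thus "u = v" using last uv by (auto simp: less_Suc_eq intro!: eq_vecI)
    qed
    moreover have "\<forall>i<Suc m. b' i \<in> K" using b(1) y(1) by (simp add: b'_def)
    ultimately have "Q (Suc m)" unfolding Q_def by blast
    thus False using m(2) by fastforce
  qed
  moreover have "ac_comb b m ` carrier_vec m \<subseteq> K" using inK[of m b] b(1) by blast
  ultimately have "bij_betw (ac_comb b m) (carrier_vec m) K" using b(2) by (auto simp: bij_betw_def)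
  thus ?thesis using that by blast
qed

text \<open>Frobenius powers are additive, and \<open>fix_all\<close> puts the base field inside the
  fixed set, which is therefore a vector space over it. Its q^m elements are counted a second time
  as roots.\<close>

lemma frobenius_fixed_basis:
  fixes e :: nat
  assumes e: "e \<ge> 1" and fix_all: "\<And>x :: 'a::{field,finite}. x ^ (CHAR('a) ^ e) = x"
  obtains b m where "bij_betw (ac_comb b m) (carrier_vec m) {x :: 'a alg_closure. x ^ (CHAR('a) ^ e) = x}"
    "CHAR('a) ^ e = CARD('a) ^ m"
proof -
  let ?P = "CHAR('a) ^ e"
  let ?K = "{x :: 'a alg_closure. x ^ ?P = x}"
  have prime: "Factorial_Ring.prime CHAR('a)" by (rule finite_field_prime_CHAR)
  obtain b m where b: "bij_betw (ac_comb b m) (carrier_vec m) ?K"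
  proof (rule ac_basis_exists[of ?K])
    show "finite ?K" by (rule card_frobenius_fixed(2)[OF e])
    show "0 \<in> ?K" using prime_gt_0_nat[OF prime] by simp
    fix x y :: "'a alg_closure" assume xy: "x \<in> ?K" "y \<in> ?K"
    have "(x + y) ^ ?P = x ^ ?P + y ^ ?P"
      by (rule freshmans_dream'[where n = e]) (simp_all add: prime)
    thus "x + y \<in> ?K" using xy by simp
  next
    fix a :: 'a and x :: "'a alg_closure" assume "x \<in> ?K"
    moreover have "to_ac a ^ ?P = to_ac a" using fix_all[of a] by (metis to_ac_power)
    ultimately show "to_ac a * x \<in> ?K" by (simp add: power_mult_distrib)
  qed blast
  have "CARD('a) ^ m = card ?K" using bij_betw_same_card[OF b] by (simp add: card_carrier_vec)
  thus ?thesis using that b card_frobenius_fixed(1)[OF e, where 'a='a] by metis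
qed

text \<open>With p the characteristic and e from Euler's theorem, the two counts give p^e = q^m. As
  m is not 0, q divides a power of the prime p and is one itself.\<close>

lemma finite_field_card_power_CHAR:
  obtains k where "k \<ge> 1" "CARD('a::{field,finite}) = CHAR('a) ^ k"
proof -
  have prime: "Factorial_Ring.prime CHAR('a)" by (rule finite_field_prime_CHAR)
  obtain e where e: "e \<ge> 1" "\<And>x :: 'a. x ^ (CHAR('a) ^ e) = x"
    using finite_field_frobenius_identity by blast
  obtain b m where bm: "CHAR('a) ^ e = CARD('a) ^ m"
    by (rule frobenius_fixed_basis[OF e]) blast
  have "CHAR('a) ^ e > 1" using prime_gt_1_nat[OF prime] e(1) by (intro one_less_power) auto
  hence "m \<noteq> 0" using bm by (intro notI) simp
  hence "CARD('a) dvd CHAR('a) ^ e" unfolding bm by (simp add: dvd_power)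
  then obtain k where k: "CARD('a) = CHAR('a) ^ k" using divides_primepow_nat[OF prime] by blast
  moreover have "k \<noteq> 0" using k field_card_gt_1[where 'a='a] by (intro notI) simp
  ultimately show ?thesis using that[of k] by simp
qed

text \<open>The multiplication matrices of the extension field of degree M, written in a basis.\<close>

lemma spread_set_exists:
  assumes M: "M \<ge> 1"
  obtains \<A> :: "'a::{field,finite} mat set" where "\<A> \<subseteq> carrier_mat M M" "card \<A> = CARD('a) ^ M"
    "\<And>A B v. A \<in> \<A> \<Longrightarrow> B \<in> \<A> \<Longrightarrow> A \<noteq> B \<Longrightarrow> v \<in> carrier_vec M \<Longrightarrow> A *\<^sub>v v = B *\<^sub>v v \<Longrightarrow> v = 0\<^sub>v M"
proof -
  obtain k where k: "k \<ge> 1" "CARD('a) = CHAR('a) ^ k" by (rule finite_field_card_power_CHAR)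
  \<comment> \<open>The exponent \<open>k * M\<close> gives the fixed set q^M elements, so its
    dimension over the base field is \<open>M\<close>.\<close>
  have eP: "CHAR('a) ^ (k * M) = CARD('a) ^ M" by (simp add: k(2) power_mult)
  define K where "K = {x :: 'a alg_closure. x ^ (CARD('a) ^ M) = x}"
  obtain b m where b0: "bij_betw (ac_comb b m) (carrier_vec m) K" "CHAR('a) ^ (k * M) = CARD('a) ^ m"
    unfolding K_def eP[symmetric]
    by (rule frobenius_fixed_basis[of "k * M", where 'a='a])
      (use k(1) M in \<open>auto simp: eP finite_field_power_card_power\<close>)
  have "m = M" using b0(2) field_card_gt_1[where 'a='a] unfolding eP by simp
  hence b: "bij_betw (ac_comb b M) (carrier_vec M) K" using b0(1) by simp
  let ?f = "ac_comb b M"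
  define g where "g = the_inv_into (carrier_vec M) ?f"
  have inj: "inj_on ?f (carrier_vec M)" and im: "?f ` carrier_vec M = K" using b by (auto simp: bij_betw_def)
  have fK: "?f v \<in> K" if "v \<in> carrier_vec M" for v using im that by blast
  have g: "g x \<in> carrier_vec M" "?f (g x) = x" if "x \<in> K" for x
    unfolding g_def using that im the_inv_into_into[OF inj _ subset_refl] f_the_inv_into_f[OF inj] by auto
  have gf: "g (?f v) = v" if "v \<in> carrier_vec M" for v unfolding g_def by (rule the_inv_into_f_f[OF inj that])
  have mK: "x * y \<in> K" if "x \<in> K" "y \<in> K" for x y using that by (simp add: K_def power_mult_distrib)
  \<comment> \<open>Multiplication by \<open>a\<close> maps \<open>K\<close> to itself and is linear
    over the base field; its matrix is taken in the basis \<open>b\<close>.\<close>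
  have "\<exists>A\<in>carrier_mat M M. \<forall>v\<in>carrier_vec M. ?f (A *\<^sub>v v) = a * ?f v" if a: "a \<in> K" for a
  proof -
    define \<phi> where "\<phi> v = g (a * ?f v)" for v
    have \<phi>: "\<phi> v \<in> carrier_vec M" "?f (\<phi> v) = a * ?f v" if "v \<in> carrier_vec M" for v
      unfolding \<phi>_def using g mK[OF a fK[OF that]] by auto
    have "linear_map class_ring (module_vec TYPE('a) M) (module_vec TYPE('a) M) \<phi>"
      unfolding linear_map_iff
    proof (intro conjI ballI allI)
      fix u :: "'a vec" assume u: "u \<in> carrier_vec M"
      show "\<phi> u \<in> carrier_vec M" by (rule \<phi>(1)[OF u])
      fix c show "\<phi> (c \<cdot>\<^sub>v u) = c \<cdot>\<^sub>v \<phi> u"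
        using \<phi> u by (intro inj_onD[OF inj]) (auto simp: ac_comb_smult algebra_simps)
    next
      fix u v :: "'a vec" assume "u \<in> carrier_vec M" "v \<in> carrier_vec M"
      thus "\<phi> (u + v) = \<phi> u + \<phi> v"
        using \<phi> by (intro inj_onD[OF inj]) (auto simp: ac_comb_add algebra_simps)
    qed
    then obtain A where "A \<in> carrier_mat M M" "\<And>v. v \<in> carrier_vec M \<Longrightarrow> A *\<^sub>v v = \<phi> v"
      by (rule linear_map_mat) blast
    thus ?thesis using \<phi>(2) by (intro bexI[of _ A]) auto
  qed
  then obtain A where A: "\<And>a. a \<in> K \<Longrightarrow> A a \<in> carrier_mat M M"
    "\<And>a v. a \<in> K \<Longrightarrow> v \<in> carrier_vec M \<Longrightarrow> ?f (A a *\<^sub>v v) = a * ?f v" by metis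
  have f0: "?f v = 0 \<Longrightarrow> v = 0\<^sub>v M" if v: "v \<in> carrier_vec M" for v
  proof -
    have "?f (0\<^sub>v M) = 0" by (simp add: ac_comb_def)
    thus "?f v = 0 \<Longrightarrow> v = 0\<^sub>v M" using inj v by (metis inj_onD zero_carrier_vec)
  qed
  have key: "v = 0\<^sub>v M" if "a \<in> K" "a' \<in> K" "a \<noteq> a'" "v \<in> carrier_vec M" "A a *\<^sub>v v = A a' *\<^sub>v v" for a a' v
  proof (rule f0[OF that(4)])
    \<comment> \<open>Two different field elements have equal products only with 0.\<close>
    have "a * ?f v = a' * ?f v" using A(2) that by metis
    thus "?f v = 0" using that(3) by simp
  qed
  have "inj_on A K"
  proof (rule inj_onI, rule ccontr)
    fix a a' assume a: "a \<in> K" "a' \<in> K" "A a = A a'" "a \<noteq> a'"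
    \<comment> \<open>By \<open>M \<ge> 1\<close> there is a nonzero vector, on which different
      multiplications differ.\<close>
    hence "unit_vec M 0 = (0\<^sub>v M :: 'a vec)" using key[of a a' "unit_vec M 0"] by simp
    thus False using M by simp
  qed
  hence "card (A ` K) = CARD('a) ^ M"
    using bij_betw_same_card[OF b] by (simp add: card_image card_carrier_vec)
  moreover have "A ` K \<subseteq> carrier_mat M M" using A(1) by blast
  ultimately show ?thesis using that[of "A ` K"] key by blast
qed

text \<open>The lifting construction for rank-metric codes: the graphs of the multiplications by the
  elements of the extension field of degree \<open>r - N\<close>, restricted to N coordinates.\<close>

lemma lifted_partial_spread:
  assumes N: "N \<ge> 1" and r: "2 * N \<le> r"
  obtains S :: "'a::{field,finite} vec set set" where "partial_spread N r S" "card S = CARD('a) ^ (r - N)"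
proof -
  define M where "M = r - N"
  have M: "M \<ge> 1" "N \<le> M" "r = M + N" using N r by (auto simp: M_def)
  obtain \<A> :: "'a mat set" where \<A>: "\<A> \<subseteq> carrier_mat M M" "card \<A> = CARD('a) ^ M"
    "\<And>A B v. A \<in> \<A> \<Longrightarrow> B \<in> \<A> \<Longrightarrow> A \<noteq> B \<Longrightarrow> v \<in> carrier_vec M \<Longrightarrow> A *\<^sub>v v = B *\<^sub>v v \<Longrightarrow> v = 0\<^sub>v M"
    using spread_set_exists[OF M(1)] by metis
  \<comment> \<open>Padding by zeros restricts a matrix of size \<open>M\<close> to its first N
    columns; \<open>2 * N \<le> r\<close> ensures that N is at most \<open>M\<close>.\<close>
  define pad where "pad x = x @\<^sub>v 0\<^sub>v (M - N)" for x :: "'a vec"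
  have pad: "pad x \<in> carrier_vec M" if "x \<in> carrier_vec N" for x
    using append_carrier_vec[OF that zero_carrier_vec[of "M - N"]] M(2) by (simp add: pad_def)
  have pad_add: "pad (x + y) = pad x + pad y" if "x \<in> carrier_vec N" "y \<in> carrier_vec N" for x y
    using that by (auto simp: pad_def intro!: eq_vecI)
  have pad_smult: "pad (a \<cdot>\<^sub>v x) = a \<cdot>\<^sub>v pad x" if "x \<in> carrier_vec N" for a x
    using that by (auto simp: pad_def intro!: eq_vecI)
  have pad_0: "x = 0\<^sub>v N" if "pad x = 0\<^sub>v M" "x \<in> carrier_vec N" for x
  proof (intro eq_vecI)
    fix i assume i: "i < dim_vec (0\<^sub>v N :: 'a vec)"
    have "pad x $ i = 0" using that i M(2) by simp
    thus "x $ i = 0\<^sub>v N $ i" using that(2) i by (simp add: pad_def)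
  qed (use that in simp)
  \<comment> \<open>A point of the graph. Its last N coordinates repeat \<open>x\<close>, so equal
    lifts have equal arguments and each graph has q^N points.\<close>
  define lift where "lift A x = (A *\<^sub>v pad x) @\<^sub>v x" for A x
  have Apad: "A *\<^sub>v pad x \<in> carrier_vec M" if "A \<in> \<A>" "x \<in> carrier_vec N" for A x
    using mult_mat_vec_carrier[of A M M "pad x"] pad that \<A>(1) by blast
  have lift_eq: "lift A x = lift B y \<longleftrightarrow> A *\<^sub>v pad x = B *\<^sub>v pad y \<and> x = y"
    if "A \<in> \<A>" "B \<in> \<A>" "x \<in> carrier_vec N" "y \<in> carrier_vec N" for A B x y
    unfolding lift_def by (rule append_vec_eq[OF Apad Apad]) (use that in auto)
  have lift_lin: "linear_map class_ring (module_vec TYPE('a) N) (module_vec TYPE('a) r) (lift A)" if A: "A \<in> \<A>" for A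
    unfolding linear_map_iff
  proof (intro conjI ballI allI)
    have Ac: "A \<in> carrier_mat M M" using A \<A>(1) by blast
    fix u :: "'a vec" assume u: "u \<in> carrier_vec N"
    show "lift A u \<in> carrier_vec r" unfolding lift_def M(3) using Apad[OF A u] u by (intro append_carrier_vec)
    fix a :: 'a show "lift A (a \<cdot>\<^sub>v u) = a \<cdot>\<^sub>v lift A u"
      unfolding lift_def pad_smult[OF u] mult_mat_vec[OF Ac pad[OF u]] using Apad[OF A u] u
      by (intro eq_vecI) auto
  next
    have Ac: "A \<in> carrier_mat M M" using A \<A>(1) by blast
    fix u v :: "'a vec" assume uv: "u \<in> carrier_vec N" "v \<in> carrier_vec N"
    show "lift A (u + v) = lift A u + lift A v"
      unfolding lift_def pad_add[OF uv] mult_add_distrib_mat_vec[OF Ac pad[OF uv(1)] pad[OF uv(2)]]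
      by (rule append_vec_add[symmetric]) (use Apad A uv in auto)
  qed
  define U where "U A = lift A ` carrier_vec N" for A
  have lin: "linear_code r (U A)" if A: "A \<in> \<A>" for A
  proof -
    obtain B where B: "B \<in> carrier_mat r N" "\<And>x. x \<in> carrier_vec N \<Longrightarrow> B *\<^sub>v x = lift A x"
      by (rule linear_map_mat[OF lift_lin[OF A]]) blast
    have "U A = (\<lambda>x. B *\<^sub>v x) ` carrier_vec N" unfolding U_def using B(2) by (intro image_cong) auto
    thus ?thesis using linear_code_image[OF B(1) linear_code_carrier] by simp
  qed
  have cd: "card (U A) = CARD('a) ^ N" if A: "A \<in> \<A>" for A
  proof -
    have "inj_on (lift A) (carrier_vec N)" using lift_eq[OF A A] by (intro inj_onI) blast
    thus ?thesis unfolding U_def by (simp add: card_image card_carrier_vec)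
  qed
  have disj: "U A \<inter> U B = {0\<^sub>v r}" if AB: "A \<in> \<A>" "B \<in> \<A>" "A \<noteq> B" for A B
  proof -
    have "lift A x = 0\<^sub>v r" if x: "x \<in> carrier_vec N" "y \<in> carrier_vec N" "lift A x = lift B y" for x y
    proof -
      have "A *\<^sub>v pad x = B *\<^sub>v pad y \<and> x = y" by (rule iffD1[OF lift_eq[OF AB(1,2) x(1,2)] x(3)])
      \<comment> \<open>\<open>A\<close> and \<open>B\<close> agree on \<open>pad x\<close>, which
        must therefore be zero.\<close>
      hence eq: "A *\<^sub>v pad x = B *\<^sub>v pad x" by metis
      have 0: "x = 0\<^sub>v N" by (rule pad_0[OF \<A>(3)[OF AB pad[OF x(1)] eq] x(1)])
      have l: "lift A (0 \<cdot>\<^sub>v x) = 0 \<cdot>\<^sub>v lift A x" "lift A x \<in> carrier_vec r"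
        using lift_lin[OF AB(1)] x(1) unfolding linear_map_iff by blast+
      have "0 \<cdot>\<^sub>v x = x" unfolding 0 by auto
      hence "lift A x = 0 \<cdot>\<^sub>v lift A x" using l(1) by metis
      also have "\<dots> = 0\<^sub>v r" using l(2) by (intro eq_vecI) auto
      finally show ?thesis .
    qed
    thus ?thesis using linear_codeD(2)[OF lin[OF AB(1)]] linear_codeD(2)[OF lin[OF AB(2)]]
      unfolding U_def by blast
  qed
  have inj: "inj_on U \<A>"
  proof (rule inj_onI, rule ccontr)
    fix A B assume AB: "A \<in> \<A>" "B \<in> \<A>" "U A = U B" "A \<noteq> B"
    hence "U A = {0\<^sub>v r}" using disj[of A B] by simp
    hence "CARD('a) ^ N = 1" using cd[OF AB(1)] by simp
    thus False using one_less_power[OF field_card_gt_1[where 'a='a], of N] N by linarith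
  qed
  have "V \<inter> W = {0\<^sub>v r}" if VW: "V \<in> U ` \<A>" "W \<in> U ` \<A>" "V \<noteq> W" for V W
  proof -
    obtain A B where "A \<in> \<A>" "B \<in> \<A>" "V = U A" "W = U B" using VW(1,2) by blast
    thus ?thesis using disj[of A B] VW(3) by metis
  qed
  hence "partial_spread N r (U ` \<A>)"
    unfolding partial_spread_iff using N r lin cd by auto
  moreover have "card (U ` \<A>) = CARD('a) ^ (r - N)" using card_image[OF inj] \<A>(2) by (simp add: M_def)
  ultimately show ?thesis using that by blast
qed

text \<open>The hypothesis on r is essential: for \<open>N < r < 2 * N\<close> a maximal-size partial spread is a single
  subspace, which does not span, but then there is no code of distance 3 with redundancy r.\<close>

lemma max_partial_spread_spans:
  assumes N: "N \<ge> 1" and S: "max_partial_spread N r (S :: 'a::{field,finite} vec set set)"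
    and r: "r = N \<or> 2 * N \<le> r" and W: "linear_code r W" and sub: "\<And>U. U \<in> S \<Longrightarrow> U \<subseteq> W"
  shows "W = carrier_vec r"
  using r
proof
  have ps: "partial_spread N r S" using S unfolding max_partial_spread_def by simp
  assume rN: "r = N"
  \<comment> \<open>For r = N the whole space alone is a partial spread, so \<open>S\<close> is
    nonempty, and any member of \<open>S\<close> already has q^r elements.\<close>
  have "partial_spread N r {carrier_vec r :: 'a vec set}"
    unfolding partial_spread_iff using N rN linear_code_carrier by (auto simp: card_carrier_vec)
  hence "card S \<ge> 1" using S unfolding max_partial_spread_def by fastforce
  then obtain U where U: "U \<in> S" by fastforce
  hence "card U = card (carrier_vec r :: 'a vec set)" "U \<subseteq> carrier_vec r"
    using ps linear_codeD(1)[of r U] rN unfolding partial_spread_iff by (auto simp: card_carrier_vec)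
  hence "U = carrier_vec r" using card_subset_eq[OF finite_carrier_vec] by blast
  thus ?thesis using sub[OF U] linear_codeD(1)[OF W] by blast
next
  let ?q = "CARD('a)"
  assume r2: "2 * N \<le> r"
  have ps: "partial_spread N r S" using S unfolding max_partial_spread_def by simp
  show ?thesis
  proof (rule ccontr)
    assume ne: "W \<noteq> carrier_vec r"
    obtain S' :: "'a vec set set" where "partial_spread N r S'" "card S' = ?q ^ (r - N)"
      using lifted_partial_spread[OF N r2] by metis
    hence "?q ^ (r - N) \<le> card S" using S unfolding max_partial_spread_def by metis
    hence "?q ^ (r - N) * (?q ^ N - 1) \<le> card S * (?q ^ N - 1)" by (rule mult_le_mono1)
    also have "\<dots> < ?q ^ (r - 1)" by (rule partial_spread_in_proper_subspace(1)[OF ps W ne sub])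
    \<comment> \<open>With the facts that follow, q^r < q^(r-1) + q^(r-N) <= 2 * q^(r-1) <=
      q^r.\<close>
    finally have "?q ^ (r - N) * ?q ^ N - ?q ^ (r - N) < ?q ^ (r - 1)" by (simp add: diff_mult_distrib2)
    moreover have "?q ^ (r - N) * ?q ^ N = ?q ^ r" using r2 by (simp flip: power_add)
    moreover have "?q ^ (r - N) \<le> ?q ^ (r - 1)"
      using N field_card_gt_1[where 'a='a] by (intro power_increasing) auto
    moreover have "2 * ?q ^ (r - 1) \<le> ?q * ?q ^ (r - 1)" using field_card_gt_1[where 'a='a] by (intro mult_le_mono1) simp
    moreover have "?q * ?q ^ (r - 1) = ?q ^ r" using N r2 by (simp flip: power_Suc)
    ultimately show False by linarith
  qed
qed

section \<open>Maximal-size spreads and proper codes\<close>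

lemma max_partial_spread_exists:
  assumes "partial_spread N r (S :: 'a::{field,finite} vec set set)"
  obtains T :: "'a::{field,finite} vec set set" where "max_partial_spread N r T"
proof -
  define P where "P k \<longleftrightarrow> (\<exists>S :: 'a vec set set. partial_spread N r S \<and> card S = k)" for k
  have "k \<le> card (Pow (carrier_vec r :: 'a vec set))" if k: "P k" for k
  proof -
    obtain S' :: "'a vec set set" where S': "partial_spread N r S'" "card S' = k" using k unfolding P_def by blast
    hence "S' \<subseteq> Pow (carrier_vec r)" unfolding partial_spread_iff linear_code_iff by auto
    thus ?thesis using S'(2) by (auto intro!: card_mono simp: finite_carrier_vec simp del: card_Pow)
  qed
  moreover have "P (card S)" unfolding P_def using assms by blast
  ultimately have "P (Greatest P)" "\<And>k. P k \<Longrightarrow> k \<le> Greatest P"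
    using GreatestI_nat[of P "card S"] Greatest_le_nat[of P] by blast+
  then obtain T :: "'a vec set set" where T: "partial_spread N r T" "\<And>k. P k \<Longrightarrow> k \<le> card T"
    unfolding P_def[of "Greatest P"] by metis
  hence "max_partial_spread N r T" unfolding max_partial_spread_def P_def by blast
  thus ?thesis using that by blast
qed

lemma SR_code3_parity_check:
  assumes "SR_code3 N r l (C :: 'a::{field,finite} vec set)"
  obtains H where "parity_check r (l * N) C H"
  using assms parity_check_exists unfolding SR_code3_def by blast

lemma proper_code_redundancy_cases:
  assumes N: "N \<ge> 1" and l: "l \<ge> 1" and C: "SR_code3 N r l (C :: 'a::{field,finite} vec set)"
  shows "r = N \<or> 2 * N \<le> r"
proof -
  obtain H where H: "parity_check r (l * N) C H" by (rule SR_code3_parity_check[OF C])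
  show ?thesis
    using spread_mat_redundancy_cases[OF _ parity_check_spread_mat[OF C H N] _ N l] H unfolding parity_check_iff by blast
qed

lemma parity_check_partial_spread:
  assumes N: "N \<ge> 1" and l: "l \<ge> 1" and C: "SR_code3 N r l (C :: 'a::{field,finite} vec set)"
    and H: "parity_check r (l * N) C H"
  shows "partial_spread N r (block_cols N l H)" "card (block_cols N l H) = l"
  using spread_mat_partial_spread[OF _ parity_check_spread_mat[OF C H N] N l] H unfolding parity_check_iff by blast+

text \<open>The code \<open>C\<close> supplies the alternative for r under which \<open>S\<close>
  spans, so the matrix of \<open>S\<close> is a parity-check matrix of a code with
  \<open>card S\<close> blocks. Properness of \<open>C\<close> bounds \<open>card S\<close> by l,
  and maximality of \<open>S\<close> against the spread of \<open>C\<close> gives the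
  converse.\<close>

lemma max_partial_spread_code:
  assumes N: "N \<ge> 1" and l: "l \<ge> 1" and C: "proper_SR_Hamming N r l (C :: 'a::{field,finite} vec set)"
    and S: "max_partial_spread N r (S :: 'a vec set set)"
  obtains E M where "proper_SR_Hamming N r l (E :: 'a vec set)" "parity_check r (l * N) E M" "block_cols N l M = S"
    "card S = l"
proof -
  have C3: "SR_code3 N r l C" and mx: "\<And>l' C'. SR_code3 N r l' (C' :: 'a vec set) \<Longrightarrow> l' \<le> l"
    using C unfolding proper_SR_Hamming_def by (auto simp: not_less)
  have ps: "partial_spread N r S" and mxS: "\<And>S' :: 'a vec set set. partial_spread N r S' \<Longrightarrow> card S' \<le> card S"
    using S unfolding max_partial_spread_def by auto
  obtain M where M: "M \<in> carrier_mat r (card S * N)" "spread_mat N r (card S) M" "block_cols N (card S) M = S"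
    by (rule partial_spread_matrix[OF ps])
  have "(\<lambda>x. M *\<^sub>v x) ` carrier_vec (card S * N) = carrier_vec r"
  proof (rule max_partial_spread_spans[OF N S proper_code_redundancy_cases[OF N l C3]])
    show "linear_code r ((\<lambda>x. M *\<^sub>v x) ` carrier_vec (card S * N))"
      by (rule linear_code_image[OF M(1) linear_code_carrier])
    fix U assume "U \<in> S"
    hence "U \<in> block_cols N (card S) M" using M(3) by simp
    thus "U \<subseteq> (\<lambda>x. M *\<^sub>v x) ` carrier_vec (card S * N)"
      unfolding block_cols_eq[OF M(1) N] by (auto simp: block_space_def)
  qed
  moreover define E where "E = {c \<in> carrier_vec (card S * N). M *\<^sub>v c = 0\<^sub>v r}"
  ultimately have pc: "parity_check r (card S * N) E M" and E3: "SR_code3 N r (card S) E"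
    using SR_code3_iff_spread_mat[OF M(1) N _ E_def] M(1,2) unfolding parity_check_iff by auto
  obtain H where H: "parity_check r (l * N) C H" by (rule SR_code3_parity_check[OF C3])
  have "l \<le> card S" using mxS parity_check_partial_spread[OF N l C3 H] by metis
  hence cS: "card S = l" using mx[OF E3] by simp
  hence "proper_SR_Hamming N r l E" using E3 C unfolding proper_SR_Hamming_def by simp
  thus ?thesis using that pc M(3) cS by simp
qed

text \<open>Every maximal-size partial spread has l members by the preceding construction, and so
  does the spread of \<open>C\<close>.\<close>

lemma proper_code_max_partial_spread:
  assumes N: "N \<ge> 1" and l: "l \<ge> 1" and C: "proper_SR_Hamming N r l (C :: 'a::{field,finite} vec set)"
    and H: "parity_check r (l * N) C H"
  shows "max_partial_spread N r (block_cols N l H)"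
proof -
  have C3: "SR_code3 N r l C" using C unfolding proper_SR_Hamming_def by simp
  note ps = parity_check_partial_spread[OF N l C3 H]
  obtain T :: "'a vec set set" where T: "max_partial_spread N r T" by (rule max_partial_spread_exists[OF ps(1)])
  have "card T = l" by (rule max_partial_spread_code[OF N l C T]) blast
  thus ?thesis using ps T unfolding max_partial_spread_def by simp
qed

section \<open>The correspondence of classes\<close>

lemma GL_equivalent_refl:
  assumes "\<And>U. U \<in> S \<Longrightarrow> U \<subseteq> carrier_vec r"
  shows "GL_equivalent r S (S :: 'a::field vec set set)"
proof -
  have "(\<lambda>v. 1\<^sub>m r *\<^sub>v v) ` U = U" if "U \<in> S" for U
  proof -
    have "(\<lambda>v. 1\<^sub>m r *\<^sub>v v) ` U = (\<lambda>v. v) ` U" using assms[OF that] by (intro image_cong) auto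
    thus ?thesis by simp
  qed
  hence "S = (\<lambda>U. (\<lambda>v. 1\<^sub>m r *\<^sub>v v) ` U) ` S" by simp
  moreover have "invertible_mat (1\<^sub>m r :: 'a mat)" using invertible_mat_iff_det[of "1\<^sub>m r :: 'a mat" r] by simp
  ultimately show ?thesis unfolding GL_equivalent_def by (intro bexI[of _ "1\<^sub>m r"]) auto
qed

lemma GL_equivalent_trans:
  assumes "GL_equivalent r S T" "GL_equivalent r T R" "\<And>U. U \<in> S \<Longrightarrow> U \<subseteq> carrier_vec r"
  shows "GL_equivalent r S (R :: 'a::field vec set set)"
proof -
  obtain A where A: "A \<in> carrier_mat r r" "invertible_mat A" "T = (\<lambda>U. (\<lambda>v. A *\<^sub>v v) ` U) ` S"
    using assms(1) unfolding GL_equivalent_def by blast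
  obtain B where B: "B \<in> carrier_mat r r" "invertible_mat B" "R = (\<lambda>U. (\<lambda>v. B *\<^sub>v v) ` U) ` T"
    using assms(2) unfolding GL_equivalent_def by blast
  have comp: "(\<lambda>v. B *\<^sub>v v) ` (\<lambda>v. A *\<^sub>v v) ` U = (\<lambda>v. (B * A) *\<^sub>v v) ` U" if "U \<in> S" for U
    using image_compose_mult[OF B(1) A(1) assms(3)[OF that]] by simp
  have "R = (\<lambda>U. (\<lambda>v. (B * A) *\<^sub>v v) ` U) ` S"
    unfolding B(3) A(3) image_image[of "\<lambda>U. (\<lambda>v. B *\<^sub>v v) ` U"] by (rule image_cong[OF refl comp])
  moreover have "invertible_mat (B * A)"
    using A(1,2) B(1,2) invertible_mat_iff_det det_mult[OF B(1) A(1)] by (metis mult_carrier_mat mult_eq_0_iff)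
  ultimately show ?thesis unfolding GL_equivalent_def using A(1) B(1) by (metis mult_carrier_mat)
qed

lemma equiv_spread_GL_rel:
  "equiv {S :: 'a::{field,finite} vec set set. max_partial_spread N r S} (spread_GL_rel N r)"
proof (rule equivI)
  have sub: "U \<subseteq> carrier_vec r" if "max_partial_spread N r S" "U \<in> S" for U and S :: "'a vec set set"
    using that linear_codeD(1)[of r U] unfolding max_partial_spread_def partial_spread_iff by blast
  show "spread_GL_rel N r \<subseteq> {S :: 'a vec set set. max_partial_spread N r S} \<times> {S. max_partial_spread N r S}"
    unfolding spread_GL_rel_def by auto
  show "refl_on {S :: 'a vec set set. max_partial_spread N r S} (spread_GL_rel N r)"
    unfolding refl_on_def spread_GL_rel_def using GL_equivalent_refl sub by blast
  show "sym (spread_GL_rel N r :: ('a vec set set \<times> 'a vec set set) set)"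
    unfolding sym_def spread_GL_rel_def using GL_equivalent_sym sub by blast
  show "trans (spread_GL_rel N r :: ('a vec set set \<times> 'a vec set set) set)"
  proof (rule transI)
    fix S T R :: "'a vec set set"
    assume a: "(S, T) \<in> spread_GL_rel N r" "(T, R) \<in> spread_GL_rel N r"
    hence "GL_equivalent r S R" using GL_equivalent_trans[of r S T R] sub[of S] unfolding spread_GL_rel_def by auto
    thus "(S, R) \<in> spread_GL_rel N r" using a unfolding spread_GL_rel_def by auto
  qed
qed

text \<open>\<open>R1\<close> is the pullback of \<open>R2\<close> along \<open>s\<close>, and
  \<open>s\<close> meets every class of \<open>R2\<close>, so it induces a bijection of classes.
  Closing the image of a class under \<open>R2\<close> describes this map without
  representatives.\<close>

lemma bij_betw_quotients:
  assumes R2: "equiv Y R2" and s: "\<And>x. x \<in> X' \<Longrightarrow> s x \<in> Y"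
    and R1: "\<And>x y. (x, y) \<in> R1 \<longleftrightarrow> x \<in> X' \<and> y \<in> X' \<and> (s x, s y) \<in> R2"
    and surj: "\<And>y. y \<in> Y \<Longrightarrow> \<exists>x\<in>X'. (s x, y) \<in> R2"
  shows "bij_betw (\<lambda>c. R2 `` (s ` c)) (X' // R1) (Y // R2)"
    and "\<And>x. x \<in> X' \<Longrightarrow> R2 `` (s ` (R1 `` {x})) = R2 `` {s x}"
proof -
  have sym: "sym R2" and trans: "trans R2" and refl: "refl_on Y R2"
    using R2 by (auto elim: equivE)
  show cls: "R2 `` (s ` (R1 `` {x})) = R2 `` {s x}" if "x \<in> X'" for x
  proof -
    have "(s x, s x) \<in> R2" using refl s[OF that] by (auto simp: refl_on_def)
    hence "s x \<in> s ` (R1 `` {x})" using that R1 by blast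
    moreover have "R2 `` {y} = R2 `` {s x}" if "y \<in> s ` (R1 `` {x})" for y
      using that R1 equiv_class_eq[OF R2] by (metis (no_types, lifting) Image_singleton_iff imageE)
    ultimately show ?thesis by blast
  qed
  have R1eq: "R1 `` {x} = R1 `` {y}" if xy: "x \<in> X'" "y \<in> X'" "R2 `` {s x} = R2 `` {s y}" for x y
  proof -
    have "(s x, s y) \<in> R2" using eq_equiv_class[OF xy(3) R2 s[OF xy(2)]] .
    hence "(s y, s x) \<in> R2" using sym by (auto dest: symD)
    have "(s x, s z) \<in> R2 \<longleftrightarrow> (s y, s z) \<in> R2" for z
      using \<open>(s x, s y) \<in> R2\<close> \<open>(s y, s x) \<in> R2\<close> trans by (meson transD)
    thus ?thesis using R1 xy by blast
  qed
  show "bij_betw (\<lambda>c. R2 `` (s ` c)) (X' // R1) (Y // R2)"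
    unfolding bij_betw_def
  proof
    show "inj_on (\<lambda>c. R2 `` (s ` c)) (X' // R1)"
    proof
      fix c d assume "c \<in> X' // R1" "d \<in> X' // R1" and eq: "R2 `` (s ` c) = R2 `` (s ` d)"
      then obtain x y where x: "x \<in> X'" "c = R1 `` {x}" and y: "y \<in> X'" "d = R1 `` {y}"
        by (auto elim!: quotientE)
      thus "c = d" using eq R1eq[OF x(1) y(1)] cls[OF x(1)] cls[OF y(1)] by simp
    qed
    show "(\<lambda>c. R2 `` (s ` c)) ` (X' // R1) = Y // R2"
    proof (intro equalityI subsetI)
      fix e assume "e \<in> (\<lambda>c. R2 `` (s ` c)) ` (X' // R1)"
      then obtain x where "x \<in> X'" "e = R2 `` {s x}" using cls by (auto elim!: quotientE)
      thus "e \<in> Y // R2" using s by (auto intro: quotientI)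
    next
      fix e assume "e \<in> Y // R2"
      then obtain y where y: "y \<in> Y" "e = R2 `` {y}" by (auto elim!: quotientE)
      then obtain x where x: "x \<in> X'" "(s x, y) \<in> R2" using surj by blast
      hence "e = R2 `` (s ` (R1 `` {x}))" using cls[OF x(1)] equiv_class_eq[OF R2 x(2)] y(2) by simp
      thus "e \<in> (\<lambda>c. R2 `` (s ` c)) ` (X' // R1)" using quotientI[OF x(1)] by blast
    qed
  qed
qed

text \<open>Replacing \<open>L\<close> by \<open>A * L\<close> leaves \<open>D\<close> unchanged but
  may move its column spaces. For given matrices equality is therefore a sufficient condition; the
  equivalence holds for a suitable parity-check matrix of \<open>D\<close>, or up to an invertible
  matrix. For the same reason isometry classes correspond to orbits of spreads and not to single
  spreads.\<close>

theorem theorem4: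
  fixes C D :: "'a::{field, finite} vec set"
    and H L :: "'a mat"
    and N r l :: nat
  assumes "N \<ge> 1" and "l \<ge> 1"
    and "proper_SR_Hamming N r l C"
    and "proper_SR_Hamming N r l D"
    and "parity_check r (l * N) C H"
    and "parity_check r (l * N) D L"
  shows "(block_cols N l H = block_cols N l L \<longrightarrow> SR_isometric N l C D) \<and>
         (SR_isometric N l C D \<longleftrightarrow>
            (\<exists>L'. parity_check r (l * N) D L' \<and> block_cols N l H = block_cols N l L')) \<and>
         (SR_isometric N l C D \<longleftrightarrow>
            GL_equivalent r (block_cols N l H) (block_cols N l L)) \<and>
         (\<exists>\<Phi>. bij_betw \<Phi>
                ({E :: 'a vec set. proper_SR_Hamming N r l E} // code_isometry_rel N r l)
                ({S :: 'a vec set set. max_partial_spread N r S} // spread_GL_rel N r) \<and>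
              (\<forall>E M. proper_SR_Hamming N r l E \<and> parity_check r (l * N) E M \<longrightarrow>
                 \<Phi> (code_isometry_rel N r l `` {E}) = spread_GL_rel N r `` {block_cols N l M}))"
proof -
  note N = assms(1) and l = assms(2) and pH = assms(5) and pL = assms(6)
  have C3: "SR_code3 N r l E" if "proper_SR_Hamming N r l E" for E :: "'a vec set"
    using that unfolding proper_SR_Hamming_def by simp
  have eq_iso: "SR_isometric N l C D" if "parity_check r (l * N) D L'" "block_cols N l H = block_cols N l L'" for L'
    by (rule block_cols_eq_imp_isometric[OF N pH that(1)
      parity_check_spread_mat[OF C3[OF assms(3)] pH N] parity_check_spread_mat[OF C3[OF assms(4)] that(1) N] that(2)])
  have iso_iff: "SR_isometric N l E F \<longleftrightarrow> GL_equivalent r (block_cols N l A) (block_cols N l B)"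
    if "proper_SR_Hamming N r l E" "proper_SR_Hamming N r l F" "parity_check r (l * N) E A" "parity_check r (l * N) F B"
    for E F :: "'a vec set" and A B
    by (rule isometric_iff_GL_equivalent[OF N C3[OF that(1)] C3[OF that(2)] that(3,4)])
  \<comment> \<open>One parity-check matrix is chosen per code; another choice stays in the same
    class of \<open>spread_GL_rel\<close>.\<close>
  define s where "s E = block_cols N l (SOME M. parity_check r (l * N) E M)" for E :: "'a vec set"
  let ?Y = "{E :: 'a vec set. proper_SR_Hamming N r l E}"
  let ?Z = "{S :: 'a vec set set. max_partial_spread N r S}"
  let ?R2 = "spread_GL_rel N r :: ('a vec set set \<times> 'a vec set set) set"
  let ?R1 = "code_isometry_rel N r l :: ('a vec set \<times> 'a vec set) set"
  have pc: "parity_check r (l * N) E (SOME M. parity_check r (l * N) E M)" if E: "proper_SR_Hamming N r l E" for E :: "'a vec set"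
  proof -
    obtain M where "parity_check r (l * N) E M" by (rule SR_code3_parity_check[OF C3[OF E]])
    thus ?thesis by (rule someI)
  qed
  have sZ: "s E \<in> ?Z" if "E \<in> ?Y" for E
    using proper_code_max_partial_spread[OF N l _ pc] that unfolding s_def by simp
  have R1: "(E, F) \<in> ?R1 \<longleftrightarrow> E \<in> ?Y \<and> F \<in> ?Y \<and> (s E, s F) \<in> ?R2" for E F
    using iso_iff[OF _ _ pc pc, of E F] sZ[of E] sZ[of F]
    unfolding code_isometry_rel_def spread_GL_rel_def by (auto simp: s_def)
  \<comment> \<open>This frees the bijection from the choice in \<open>s\<close>, so that its value
    can be computed from any parity-check matrix \<open>M\<close>.\<close>
  have sM: "(s E, block_cols N l M) \<in> ?R2" if E: "proper_SR_Hamming N r l E" and M: "parity_check r (l * N) E M" for E M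
  proof -
    have M': "M' \<in> carrier_mat r (l * N)" if "parity_check r (l * N) E M'" for M'
      using that unfolding parity_check_iff by simp
    obtain A where A: "A \<in> carrier_mat r r" "invertible_mat A" "M = A * (SOME M. parity_check r (l * N) E M)"
      by (rule parity_check_unique[OF pc[OF E] M])
    have "block_cols N l M = (\<lambda>U. (\<lambda>v. A *\<^sub>v v) ` U) ` s E"
      unfolding s_def A(3) by (rule block_cols_mult_left[OF A(1) M'[OF pc[OF E]] N])
    hence "GL_equivalent r (s E) (block_cols N l M)" unfolding GL_equivalent_def using A(1,2) by blast
    thus ?thesis using sZ[of E] E proper_code_max_partial_spread[OF N l E M] unfolding spread_GL_rel_def by simp
  qed
  have surj: "\<exists>E\<in>?Y. (s E, S) \<in> ?R2" if S: "S \<in> ?Z" for S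
  proof -
    \<comment> \<open>Surjectivity on classes rests on the given code \<open>C\<close>: its
      existence makes maximal-size spreads span and have l members.\<close>
    obtain E M where "proper_SR_Hamming N r l E" "parity_check r (l * N) E M" "block_cols N l M = S"
      using max_partial_spread_code[OF N l assms(3), of S] S by (metis mem_Collect_eq)
    thus ?thesis using sM by blast
  qed
  note quot = bij_betw_quotients[OF equiv_spread_GL_rel[of N r, where 'a='a] sZ R1 surj]
  have "?R2 `` (s ` (?R1 `` {E})) = ?R2 `` {block_cols N l M}"
    if E: "proper_SR_Hamming N r l E" and M: "parity_check r (l * N) E M" for E M
    using quot(2)[of E] E equiv_class_eq[OF equiv_spread_GL_rel sM[OF E M]] by simp
  hence "\<exists>\<Phi>. bij_betw \<Phi> (?Y // ?R1) (?Z // ?R2) \<and>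
      (\<forall>E M. proper_SR_Hamming N r l E \<and> parity_check r (l * N) E M \<longrightarrow>
         \<Phi> (?R1 `` {E}) = ?R2 `` {block_cols N l M})"
    using quot(1) by blast
  moreover have "SR_isometric N l C D \<longleftrightarrow>
      (\<exists>L'. parity_check r (l * N) D L' \<and> block_cols N l H = block_cols N l L')"
    using eq_iso isometric_imp_parity_check[OF N pH, of D] by metis
  ultimately show ?thesis using eq_iso[OF pL] iso_iff[OF assms(3-6)] by blast
qed

end
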